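(* Let $d\ge3$. There are constants $c,c'>0$ depending only on $d$ such that for every $u>0$, $$\lim_{N\to\infty}P\Big[e^{-cu}\le\frac{|E\setminus X_{[0,uN^d]}|}{N^d}\le e^{-c'u}\Big]=1 .$$
   Context: $E=(\mathbb Z/N\mathbb Z)^d$ is the discrete torus. $P$ is the law of simple random walk $(X_n)_{n\ge0}$ on $E$ (each step adds one of $\pm e_1,\dots,\pm e_d$ with probability $1/(2d)$) started from the uniform distribution. $X_{[0,t]}=\{X_n:0\le n\le t\}$, and $|A|$ denotes the cardinality of $A\subseteq E$. *)

theory Defs
  imports "HOL-Probability.Probability"
begin

text \<open>The vertex set of $(Z/NZ)^d$: each class modulo $N$ is given by its representative in
  $0, \ldots, N-1$, and coordinates are indexed by $0, \ldots, d-1$.\<close>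

definition torus :: "nat \<Rightarrow> nat \<Rightarrow> (nat \<Rightarrow> int) set" where
  "torus d N = {..<d} \<rightarrow>\<^sub>E {0..<int N}"

text \<open>A direction \<open>(i, s)\<close> with \<open>s = \<plusminus>1\<close> encodes the increment $s e_i$.  Using the pair rather than
  the vector keeps $e_i$ and $-e_i$ apart when they coincide modulo $N$ (that is, for $N \le 2$), so
  that each signed direction has probability $1/(2d)$ for every $N$.\<close>

definition directions :: "nat \<Rightarrow> (nat \<times> int) set" where
  "directions d = {..<d} \<times> {1, -1}"

definition torus_step :: "nat \<Rightarrow> (nat \<Rightarrow> int) \<Rightarrow> nat \<times> int \<Rightarrow> nat \<Rightarrow> int" where
  "torus_step N x v = x(fst v := (x (fst v) + snd v) mod int N)"

primrec walk :: "nat \<Rightarrow> (nat \<Rightarrow> int) \<times> (nat \<Rightarrow> nat \<times> int) \<Rightarrow> nat \<Rightarrow> nat \<Rightarrow> int" where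
  "walk N \<omega> 0 = fst \<omega>"
| "walk N \<omega> (Suc n) = torus_step N (walk N \<omega> n) (snd \<omega> n)"

text \<open>The driving randomness: a uniform starting point and, independently of it, a sequence of
  i.i.d. uniform directions.  For $N = 0$ the torus is empty (if $d > 0$) and the first factor has
  no meaning; only large $N$ matter.\<close>

definition driving :: "nat \<Rightarrow> nat \<Rightarrow> ((nat \<Rightarrow> int) \<times> (nat \<Rightarrow> nat \<times> int)) measure" where
  "driving d N = measure_pmf (pmf_of_set (torus d N)) \<Otimes>\<^sub>M
     (\<Pi>\<^sub>M n\<in>UNIV. measure_pmf (pmf_of_set (directions d)))"

text \<open>The law $P$ of the walk, on the space of trajectories; $X_n$ is the \<open>n\<close>-th coordinate map.\<close>

definition srw_law :: "nat \<Rightarrow> nat \<Rightarrow> (nat \<Rightarrow> nat \<Rightarrow> int) measure" where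
  "srw_law d N = distr (driving d N) (\<Pi>\<^sub>M n\<in>UNIV. count_space UNIV) (walk N)"

definition visited :: "(nat \<Rightarrow> nat \<Rightarrow> int) \<Rightarrow> real \<Rightarrow> (nat \<Rightarrow> int) set" where
  "visited X t = {X n | n. real n \<le> t}"

lemma space_srw_law [simp]: "space (srw_law d N) = UNIV"
  by (simp add: srw_law_def space_PiM)

lemma measurable_walk: "walk N \<in> driving d N \<rightarrow>\<^sub>M (\<Pi>\<^sub>M n\<in>UNIV. count_space UNIV)"
proof (rule measurable_PiM_single')
  fix n
  show "(\<lambda>\<omega>. walk N \<omega> n) \<in> driving d N \<rightarrow>\<^sub>M count_space UNIV"
  proof (induction n)
    case 0
    have "fst \<in> driving d N \<rightarrow>\<^sub>M measure_pmf (pmf_of_set (torus d N))"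
      unfolding driving_def by (rule measurable_fst)
    then show ?case by simp
  next
    case (Suc n)
    have dir: "(\<lambda>\<omega>. snd \<omega> n) \<in> driving d N \<rightarrow>\<^sub>M measure_pmf (pmf_of_set (directions d))"
      unfolding driving_def by measurable
    then have "(\<lambda>\<omega>. snd \<omega> n) \<in> driving d N \<rightarrow>\<^sub>M count_space UNIV"
      by simp
    moreover have "(\<lambda>\<omega>. torus_step N (walk N \<omega> n) v) \<in> driving d N \<rightarrow>\<^sub>M count_space UNIV" for v
      by (rule measurable_compose[OF Suc]) simp
    ultimately show ?case
      by (simp add: measurable_compose_countable[where g = "\<lambda>\<omega>. snd \<omega> n"])
  qed
qed (simp add: space_PiM)

lemma prob_space_srw_law: "prob_space (srw_law d N)"
proof -
  interpret dirs: product_prob_space "\<lambda>_. measure_pmf (pmf_of_set (directions d))" "UNIV :: nat set"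
    by unfold_locales
  interpret pair_prob_space "measure_pmf (pmf_of_set (torus d N))"
    "\<Pi>\<^sub>M n\<in>(UNIV :: nat set). measure_pmf (pmf_of_set (directions d))"
    by unfold_locales
  have "prob_space (driving d N)"
    unfolding driving_def by unfold_locales
  then show ?thesis
    unfolding srw_law_def using measurable_walk by (rule prob_space.prob_space_distr)
qed

end

(* Cut the walk into blocks of tau + 2 l steps with N^2 << tau << l << N^d.  After tau steps the
   walk is mixed up to parity, and since d >= 3 the Green function is bounded uniformly in N, so
   whatever the past, each point x is visited during the last 2 l steps of a block with probability
   between a and b, both of order l / N^d.  Hence the vacant density shrinks in each block, in
   conditional mean, by a factor between 1 - b and 1 - a, up to the proportion tau / N^d that the
   mixing period can cover.  One block changes the density by at most delta = (tau + 2 l) / N^d, so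
   over the u / delta blocks up to time u N^d the squared fluctuations add up to u delta, which
   vanishes: the density stays between the two geometric decays.

   Heat kernel and Green function bounds come from the Fourier expansion on the torus. *)

theory Submission
  imports Defs "HOL-Real_Asymp.Real_Asymp"
begin

section \<open>Averages over finite sequences of directions\<close>

text \<open>For even \<open>N\<close> the walk is bipartite, so the heat kernel at a single time
  never settles; only the sum over two consecutive times comes close to \<open>2 / N^d\<close>.
  Windows are therefore counted in \<open>l\<close> pairs of times. The expected number of visits to
  \<open>x\<close> in a window bounds the hitting probability from above; divided by a bound for the
  expected number of returns, it bounds it from below.

  The conditional mean of the density is known only through inequalities, so no exact martingale is
  available. What is propagated through the blocks is the second moment of a positive part, for
  which a one-sided drift suffices; correlations between different points never have to be computed.

  Before the transfer to the law of the walk, every expectation is a finite average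
  \<open>dir_avg\<close>, whose recursion on the first direction turns the Markov property into an
  identity of sums.

  The sizes are \<open>\<tau> = N^2 r\<close> and \<open>l = N^2 r^2\<close> with \<open>r\<close>
  of order \<open>d^2 ln N\<close>: enough to mix to precision \<open>N^(-d)\<close>, a vanishing
  ratio \<open>\<tau> / l\<close>, and still far below \<open>N^3\<close>.\<close>

primrec dir_avg :: "nat \<Rightarrow> nat \<Rightarrow> ((nat \<times> int) list \<Rightarrow> real) \<Rightarrow> real" where
  "dir_avg d 0 F = F []"
| "dir_avg d (Suc n) F = (\<Sum>v\<in>directions d. dir_avg d n (\<lambda>vs. F (v # vs))) / (2 * real d)"

lemma finite_directions [simp]: "finite (directions d)"
  by (simp add: directions_def)

lemma card_directions [simp]: "card (directions d) = 2 * d"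
  by (simp add: directions_def card_cartesian_product)

lemma dir_avg_mono:
  assumes "\<And>vs. length vs = n \<Longrightarrow> set vs \<subseteq> directions d \<Longrightarrow> F vs \<le> G vs"
  shows "dir_avg d n F \<le> dir_avg d n G"
  using assms
proof (induction n arbitrary: F G)
  case (Suc n)
  have "dir_avg d n (\<lambda>vs. F (v # vs)) \<le> dir_avg d n (\<lambda>vs. G (v # vs))" if "v \<in> directions d" for v
    by (rule Suc.IH) (use Suc.prems that in auto)
  then show ?case
    by (auto intro!: divide_right_mono sum_mono)
qed auto

lemma dir_avg_const: "d > 0 \<Longrightarrow> dir_avg d n (\<lambda>_. c) = c"
  by (induction n) auto

lemma dir_avg_sum: "dir_avg d n (\<lambda>vs. \<Sum>x\<in>A. F x vs) = (\<Sum>x\<in>A. dir_avg d n (F x))"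
proof (induction n arbitrary: F)
  case (Suc n)
  show ?case
    by (simp add: Suc.IH sum_divide_distrib) (rule sum.swap)
qed auto

lemma dir_avg_add: "dir_avg d n (\<lambda>vs. F vs + G vs) = dir_avg d n F + dir_avg d n G"
  by (induction n arbitrary: F G) (auto simp: sum.distrib add_divide_distrib)

lemma dir_avg_diff: "dir_avg d n (\<lambda>vs. F vs - G vs) = dir_avg d n F - dir_avg d n G"
  by (induction n arbitrary: F G) (auto simp: sum_subtractf diff_divide_distrib)

lemma dir_avg_cmult: "dir_avg d n (\<lambda>vs. c * F vs) = c * dir_avg d n F"
  by (induction n arbitrary: F) (auto simp: sum_distrib_left[symmetric])

text \<open>The tower property. As \<open>foldl\<close> and \<open>vis\<close> split over
  \<open>@\<close>, this is how the Markov property at time \<open>m\<close> is used.\<close>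

lemma dir_avg_append:
  "dir_avg d (m + n) F = dir_avg d m (\<lambda>us. dir_avg d n (\<lambda>vs. F (us @ vs)))"
  by (induction m arbitrary: F) auto

section \<open>Transition probabilities and their Fourier expansion\<close>

lemma finite_torus [simp]: "finite (torus d N)"
  by (simp add: torus_def finite_PiE)

lemma card_torus: "card (torus d N) = N ^ d"
  by (simp add: torus_def card_PiE)

lemma torus_step_in_torus:
  assumes "z \<in> torus d N" "v \<in> directions d" "N > 0"
  shows "torus_step N z v \<in> torus d N"
  using assms unfolding torus_def torus_step_def directions_def
  by (auto simp: PiE_iff extensional_def)

lemma foldl_torus_step_in_torus:
  assumes "z \<in> torus d N" "set vs \<subseteq> directions d" "N > 0"
  shows "foldl (torus_step N) z vs \<in> torus d N"
  using assms by (induction vs arbitrary: z) (auto intro: torus_step_in_torus)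

text \<open>The transition probability of \<open>n\<close> steps from \<open>z\<close> to
  \<open>x\<close>, that is, the heat kernel.\<close>

definition heat :: "nat \<Rightarrow> nat \<Rightarrow> nat \<Rightarrow> (nat \<Rightarrow> int) \<Rightarrow> (nat \<Rightarrow> int) \<Rightarrow> real" where
  "heat d N n z x = dir_avg d n (\<lambda>vs. of_bool (foldl (torus_step N) z vs = x))"

lemma heat_0: "heat d N 0 z x = of_bool (z = x)"
  by (simp add: heat_def)

lemma heat_Suc: "heat d N (Suc n) z x = (\<Sum>v\<in>directions d. heat d N n (torus_step N z v) x) / (2 * real d)"
  by (simp add: heat_def)

text \<open>Chapman-Kolmogorov; it averages out the mixing steps that precede a window.\<close>

lemma heat_add: "dir_avg d m (\<lambda>us. heat d N n (foldl (torus_step N) z us) x) = heat d N (m + n) z x"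
  by (simp add: heat_def dir_avg_append)

lemma heat_nonneg: "d > 0 \<Longrightarrow> heat d N n z x \<ge> 0"
  unfolding heat_def using dir_avg_mono[of n d "\<lambda>_. 0"] by (simp add: dir_avg_const)

definition tchar :: "nat \<Rightarrow> nat \<Rightarrow> (nat \<Rightarrow> int) \<Rightarrow> (nat \<Rightarrow> int) \<Rightarrow> complex" where
  "tchar d N k x = (\<Prod>j<d. cis (2 * pi * of_int (k j) * of_int (x j) / real N))"

text \<open>The eigenvalue of the transition operator at the character \<open>tchar d N k\<close>.
  It is real because each direction is paired with its opposite, see
  \<open>sum_tchar_torus_step\<close>.\<close>

definition eigval :: "nat \<Rightarrow> nat \<Rightarrow> (nat \<Rightarrow> int) \<Rightarrow> real" where
  "eigval d N k = (\<Sum>j<d. cos (2 * pi * of_int (k j) / real N)) / real d"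

lemma norm_tchar [simp]: "norm (tchar d N k x) = 1"
  by (simp add: tchar_def prod_norm[symmetric])

text \<open>\<open>torus_step\<close> reduces modulo \<open>N\<close>. An integer frequency does not
  see the reduction, which makes \<open>tchar\<close> a character of the quotient group.\<close>

lemma cis_mod:
  assumes "N > 0"
  shows "cis (2 * pi * of_int k * of_int (a mod int N) / real N) = cis (2 * pi * of_int k * of_int a / real N)"
proof -
  have "real_of_int a = of_int (a mod int N) + real N * of_int (a div int N)"
    by (metis mod_mult_div_eq of_int_add of_int_mult of_int_of_nat_eq)
  then have "2 * pi * of_int k * of_int a / real N
      = 2 * pi * of_int k * of_int (a mod int N) / real N + 2 * pi * of_int (k * (a div int N))"
    using assms by (simp add: field_simps)
  moreover have "cis (2 * pi * of_int (k * (a div int N))) = 1"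
    by (rule cis_multiple_2pi) auto
  ultimately show ?thesis
    by (simp add: cis_mult[symmetric] del: of_int_mult)
qed

lemma tchar_torus_step:
  assumes "N > 0" "i < d"
  shows "tchar d N k (torus_step N z (i, s)) = tchar d N k z * cis (2 * pi * of_int (k i) * of_int s / real N)"
proof -
  have "tchar d N k (torus_step N z (i, s)) = cis (2 * pi * of_int (k i) * of_int ((z i + s) mod int N) / real N)
     * (\<Prod>j\<in>{..<d}-{i}. cis (2 * pi * of_int (k j) * of_int (z j) / real N))"
    unfolding tchar_def using assms by (subst prod.remove[of _ i]) (auto simp: torus_step_def intro!: prod.cong)
  moreover have "tchar d N k z = cis (2 * pi * of_int (k i) * of_int (z i) / real N)
     * (\<Prod>j\<in>{..<d}-{i}. cis (2 * pi * of_int (k j) * of_int (z j) / real N))"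
    unfolding tchar_def using assms by (subst prod.remove[of _ i]) auto
  ultimately show ?thesis
    unfolding cis_mod[OF assms(1)] by (simp add: cis_mult algebra_simps add_divide_distrib)
qed

lemma sum_tchar_torus_step:
  assumes "N > 0" "d > 0"
  shows "(\<Sum>v\<in>directions d. tchar d N k (torus_step N z v)) = of_real (2 * real d * eigval d N k) * tchar d N k z"
proof -
  have *: "cis t + cis (-t) = of_real (2 * cos t)" for t
    by (simp add: complex_eq_iff)
  have "(\<Sum>v\<in>directions d. tchar d N k (torus_step N z v))
     = (\<Sum>i<d. \<Sum>s\<in>{1,-1}. tchar d N k (torus_step N z (i, s)))"
    unfolding directions_def sum.cartesian_product by (intro sum.cong) auto
  also have "\<dots> = (\<Sum>i<d. tchar d N k z * of_real (2 * cos (2 * pi * of_int (k i) / real N)))"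
    using assms by (intro sum.cong refl) (simp add: tchar_torus_step ring_distribs(1)[symmetric] * del: of_real_mult)
  also have "\<dots> = of_real (2 * real d * eigval d N k) * tchar d N k z"
    using assms by (simp add: eigval_def sum_distrib_left[symmetric])
  finally show ?thesis .
qed

text \<open>A geometric series whose ratio is an \<open>N\<close>-th root of unity. The range of
  \<open>m\<close> contains no multiple of \<open>N\<close> besides \<open>0\<close>, so otherwise
  the ratio is not \<open>1\<close>.\<close>

lemma sum_roots_of_unity:
  assumes "N > 0" "\<bar>m\<bar> < int N"
  shows "(\<Sum>k\<in>{0..<int N}. cis (2 * pi * of_int k * of_int m / real N)) = (if m = 0 then of_nat N else 0)"
proof (cases "m = 0")
  case False
  let ?w = "cis (2 * pi * of_int m / real N)"
  have bij: "bij_betw int {..<N} {0..<int N}"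
    by (auto simp: bij_betw_def inj_on_def image_int_atLeastLessThan lessThan_atLeast0)
  have "(\<Sum>k\<in>{0..<int N}. cis (2 * pi * of_int k * of_int m / real N)) = (\<Sum>k<N. ?w ^ k)"
    by (subst sum.reindex_bij_betw[OF bij, symmetric])
       (auto intro!: sum.cong simp: Complex.DeMoivre mult_ac)
  moreover have "?w ^ N = 1"
    using assms by (simp add: Complex.DeMoivre cis_multiple_2pi)
  moreover have "?w \<noteq> 1"
  proof
    assume "?w = 1"
    then have "cos (2 * pi * of_int m / real N) = 1"
      by (simp add: complex_eq_iff)
    then obtain n :: int where "2 * pi * of_int m / real N = of_int n * 2 * pi"
      by (auto simp: cos_one_2pi_int)
    then have "real_of_int m = of_int (n * int N)"
      using assms by (simp add: field_simps)
    then have "m = n * int N"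
      by linarith
    with assms have "\<bar>n\<bar> * int N < 1 * int N"
      by (simp add: abs_mult)
    then have "n = 0"
      using mult_less_cancel_right_disj[of "\<bar>n\<bar>" "int N" 1] by auto
    with \<open>m = n * int N\<close> False show False
      by simp
  qed
  ultimately show ?thesis
    using False by (simp add: sum_gp_strict)
qed (use assms in simp)

lemma tchar_orthogonality:
  assumes "N > 0" "z \<in> torus d N" "x \<in> torus d N"
  shows "(\<Sum>k\<in>torus d N. tchar d N k z * cnj (tchar d N k x)) = (if z = x then of_nat N ^ d else 0)"
proof -
  have "(\<Sum>k\<in>torus d N. tchar d N k z * cnj (tchar d N k x))
    = (\<Sum>k\<in>torus d N. \<Prod>j<d. cis (2 * pi * of_int (k j) * of_int (z j - x j) / real N))"
    by (simp add: tchar_def cnj_prod cis_cnj cis_mult prod.distrib[symmetric] algebra_simps diff_divide_distrib)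
  also have "\<dots> = (\<Prod>j<d. \<Sum>k\<in>{0..<int N}. cis (2 * pi * of_int k * of_int (z j - x j) / real N))"
    unfolding torus_def by (subst prod_sum_PiE) auto
  also have "\<dots> = (\<Prod>j<d. if z j - x j = 0 then of_nat N else 0)"
  proof (intro prod.cong refl sum_roots_of_unity assms(1))
    fix j assume "j \<in> {..<d}"
    then have "z j \<in> {0..<int N}" "x j \<in> {0..<int N}"
      using assms by (auto simp: torus_def PiE_iff)
    then show "\<bar>z j - x j\<bar> < int N"
      by auto
  qed
  also have "\<dots> = (if z = x then of_nat N ^ d else 0)"
  proof (cases "z = x")
    case False
    then obtain j where "j < d" "z j \<noteq> x j"
      using assms unfolding torus_def by (metis PiE_ext lessThan_iff)
    then show ?thesis
      using False by auto
  qed simp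
  finally show ?thesis .
qed

text \<open>Orthogonality expands the point mass at \<open>x\<close> in characters, and every step
  multiplies each coefficient by its eigenvalue.\<close>

lemma heat_Fourier:
  assumes "N > 0" "d > 0" "z \<in> torus d N" "x \<in> torus d N"
  shows "complex_of_real (heat d N n z x)
    = (\<Sum>k\<in>torus d N. of_real (eigval d N k ^ n) * (tchar d N k z * cnj (tchar d N k x))) / of_nat N ^ d"
  using assms(3)
proof (induction n arbitrary: z)
  case 0
  then show ?case
    using assms by (simp add: heat_0 tchar_orthogonality)
next
  case (Suc n)
  let ?c = "\<lambda>k. of_real (eigval d N k ^ n) * cnj (tchar d N k x) :: complex"
  have "complex_of_real (heat d N (Suc n) z x)
    = (\<Sum>v\<in>directions d. (\<Sum>k\<in>torus d N. ?c k * tchar d N k (torus_step N z v)) / of_nat N ^ d) / (2 * of_nat d)"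
    using assms Suc by (simp add: heat_Suc torus_step_in_torus mult_ac)
  also have "\<dots> = (\<Sum>k\<in>torus d N. ?c k * (\<Sum>v\<in>directions d. tchar d N k (torus_step N z v))) / of_nat N ^ d / (2 * of_nat d)"
    unfolding sum_divide_distrib[symmetric] sum_distrib_left by (subst sum.swap) simp
  also have "\<dots> = (\<Sum>k\<in>torus d N. ?c k * (of_real (2 * real d * eigval d N k) * tchar d N k z)) / of_nat N ^ d / (2 * of_nat d)"
    using assms by (simp add: sum_tchar_torus_step)
  also have "\<dots> = (\<Sum>k\<in>torus d N. of_real (eigval d N k ^ Suc n) * (tchar d N k z * cnj (tchar d N k x))) / of_nat N ^ d"
    using assms by (simp add: sum_divide_distrib mult_ac)
  finally show ?case .
qed

section \<open>Spectral bounds\<close>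

text \<open>Jordan's inequality: by concavity the graph of the sine lies above its chord from
  \<open>0\<close> to \<open>pi / 2\<close>.\<close>

lemma sin_ge_linear:
  assumes "0 \<le> x" "x \<le> pi / 2"
  shows "2 * x / pi \<le> sin x"
proof -
  have "concave_on {0..pi} sin"
  proof (rule f''_le0_imp_concave)
    show "(sin has_real_derivative cos x) (at x)" for x :: real
      by (auto intro!: derivative_eq_intros)
    show "(cos has_real_derivative - sin x) (at x)" for x :: real
      by (auto intro!: derivative_eq_intros)
  qed (auto intro: sin_ge_zero)
  from concave_onD[OF this, of "2 * x / pi" 0 "pi / 2"] assms show ?thesis
    by (simp add: divide_simps)
qed

lemma one_minus_cos_ge:
  assumes "\<bar>x\<bar> \<le> pi"
  shows "2 * x\<^sup>2 / pi\<^sup>2 \<le> 1 - cos x"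
proof -
  have "\<bar>x\<bar> / pi \<le> sin (\<bar>x\<bar> / 2)"
    using sin_ge_linear[of "\<bar>x\<bar> / 2"] assms by simp
  then have "(\<bar>x\<bar> / pi)\<^sup>2 \<le> (sin (\<bar>x\<bar> / 2))\<^sup>2"
    by (intro power_mono) auto
  moreover have "1 - cos x = 2 * (sin (\<bar>x\<bar> / 2))\<^sup>2"
    using cos_double_sin[of "\<bar>x\<bar> / 2"] by simp
  ultimately show ?thesis
    by (simp add: power_divide)
qed

text \<open>The distance from \<open>m\<close> to \<open>0\<close> on the cycle, for the
  representative \<open>m\<close> in \<open>0, ..., N - 1\<close>: frequencies close to
  \<open>N\<close> are as low as those close to \<open>0\<close>.\<close>

definition cyc_norm :: "nat \<Rightarrow> int \<Rightarrow> real" where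
  "cyc_norm N m = min (of_int m) (real N - of_int m)"

text \<open>\<open>m\<close> and \<open>N - m\<close> give the same cosine, and the smaller one an
  angle of at most \<open>pi\<close>. Putting \<open>2 * pi * cyc_norm N m / N\<close> into the
  quadratic bound produces the constant \<open>8\<close>.\<close>

lemma one_minus_cos_cyc_norm:
  assumes "m \<in> {0..<int N}"
  shows "8 * (cyc_norm N m)\<^sup>2 / (real N)\<^sup>2 \<le> 1 - cos (2 * pi * of_int m / real N)"
proof -
  have N: "N > 0" "0 \<le> m" "real_of_int m < real N"
    using assms by auto
  have "cos (2 * pi * (real N - of_int m) / real N) = cos (2 * pi * of_int m / real N)"
    using N by (simp add: right_diff_distrib diff_divide_distrib cos_diff)
  then have "cos (2 * pi * cyc_norm N m / real N) = cos (2 * pi * of_int m / real N)"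
    by (simp add: cyc_norm_def min_def)
  moreover have "0 \<le> cyc_norm N m" "2 * cyc_norm N m \<le> real N"
    using N by (auto simp: cyc_norm_def min_def)
  ultimately show ?thesis
    using one_minus_cos_ge[of "2 * pi * cyc_norm N m / real N"] N
    by (simp add: power_mult_distrib power_divide divide_simps)
qed

lemma cyc_norm_ge_1:
  assumes "m \<in> {0..<int N}" "m \<noteq> 0"
  shows "cyc_norm N m \<ge> 1"
proof -
  have "1 \<le> m" "m \<le> int N - 1"
    using assms by auto
  then have "1 \<le> real_of_int m" "real_of_int m \<le> of_int (int N - 1)"
    by linarith+
  then show ?thesis
    by (simp add: cyc_norm_def)
qed

lemma torus_mem: "k \<in> torus d N \<Longrightarrow> j < d \<Longrightarrow> k j \<in> {0..<int N}"
  by (auto simp: torus_def PiE_iff)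

definition torus_zero :: "nat \<Rightarrow> nat \<Rightarrow> int" where
  "torus_zero d = (\<lambda>j. if j < d then 0 else undefined)"

lemma torus_zero_in_torus: "N > 0 \<Longrightarrow> torus_zero d \<in> torus d N"
  by (auto simp: torus_def torus_zero_def PiE_iff extensional_def)

lemma eigval_torus_zero: "d > 0 \<Longrightarrow> eigval d N (torus_zero d) = 1"
  by (simp add: eigval_def torus_zero_def)

lemma tchar_torus_zero: "tchar d N (torus_zero d) x = 1"
  by (simp add: tchar_def torus_zero_def)

lemma obtain_nonzero_coordinate:
  assumes "k \<in> torus d N" "k \<noteq> torus_zero d"
  obtains j where "j < d" "k j \<noteq> 0"
proof -
  have "\<exists>j<d. k j \<noteq> 0"
  proof (rule ccontr)
    assume "\<not> (\<exists>j<d. k j \<noteq> 0)"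
    then have "k j = torus_zero d j" for j
      using assms(1) by (cases "j < d") (auto simp: torus_def torus_zero_def PiE_iff extensional_def)
    with assms(2) show False
      by auto
  qed
  with that show thesis
    by blast
qed

lemma abs_eigval_le_1: "\<bar>eigval d N k\<bar> \<le> 1"
proof -
  have "\<bar>\<Sum>j<d. cos (2 * pi * of_int (k j) / real N)\<bar> \<le> (\<Sum>j<d. 1)"
    by (rule order_trans[OF sum_abs]) (intro sum_mono, simp)
  then show ?thesis
    by (cases "d = 0") (auto simp: eigval_def abs_divide)
qed

lemma one_minus_eigval_ge:
  assumes "d > 0" "k \<in> torus d N"
  shows "8 * (\<Sum>j<d. (cyc_norm N (k j))\<^sup>2) / (real d * (real N)\<^sup>2) \<le> 1 - eigval d N k"
proof -
  have "(\<Sum>j<d. 8 * (cyc_norm N (k j))\<^sup>2 / (real N)\<^sup>2) \<le> (\<Sum>j<d. 1 - cos (2 * pi * of_int (k j) / real N))"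
    using assms by (intro sum_mono one_minus_cos_cyc_norm torus_mem) auto
  then have "(\<Sum>j<d. 8 * (cyc_norm N (k j))\<^sup>2 / (real N)\<^sup>2) / real d
      \<le> (\<Sum>j<d. 1 - cos (2 * pi * of_int (k j) / real N)) / real d"
    by (intro divide_right_mono) auto
  then show ?thesis
    using assms(1) by (simp add: eigval_def sum_subtractf diff_divide_distrib sum_distrib_left sum_divide_distrib mult.commute)
qed

lemma sum_cyc_norm_ge_1:
  assumes "k \<in> torus d N" "k \<noteq> torus_zero d"
  shows "(\<Sum>j<d. (cyc_norm N (k j))\<^sup>2) \<ge> 1"
proof -
  obtain j where j: "j < d" "k j \<noteq> 0"
    using obtain_nonzero_coordinate assms .
  have "1 \<le> (cyc_norm N (k j))\<^sup>2"
    using cyc_norm_ge_1[of "k j" N] torus_mem[OF assms(1) j(1)] j(2) by simp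
  also have "\<dots> \<le> (\<Sum>j<d. (cyc_norm N (k j))\<^sup>2)"
    using j by (intro member_le_sum) auto
  finally show ?thesis .
qed

text \<open>The gap at $-1$ fails exactly for the eigenvalue $-1$ itself, which comes from the
  bipartite structure for even \<open>N\<close>.\<close>

lemma one_plus_eigval_ge:
  assumes "d > 0" "N > 0" "k \<in> torus d N" "eigval d N k \<noteq> -1"
  shows "2 / (real d * (real N)\<^sup>2) \<le> 1 + eigval d N k"
proof -
  \<comment> \<open>Shifting an angle by \<open>pi\<close> flips the sign of its cosine, so
    \<open>1 + eigval\<close> is an average of nonnegative terms \<open>1 - cos (?t j)\<close>. One
    coordinate with \<open>2 * k j \<noteq> N\<close> suffices, since a nonzero integer has modulus
    at least \<open>1\<close>.\<close>
  let ?t = "\<lambda>j. pi * of_int (2 * k j - int N) / real N"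
  have cos_eq: "cos (2 * pi * of_int (k j) / real N) = - cos (?t j)" for j
  proof -
    have "?t j = 2 * pi * of_int (k j) / real N - pi"
      using assms by (simp add: field_simps)
    then show ?thesis
      by simp
  qed
  have "\<exists>j<d. 2 * k j \<noteq> int N"
  proof (rule ccontr)
    assume "\<not> (\<exists>j<d. 2 * k j \<noteq> int N)"
    then have "eigval d N k = (\<Sum>j<d. -1) / real d"
      unfolding eigval_def cos_eq by (intro arg_cong2[where f = "(/)"] sum.cong) auto
    with assms show False
      by simp
  qed
  then obtain j where j: "j < d" "2 * k j \<noteq> int N"
    by blast
  have kj: "0 \<le> k j" "k j < int N"
    using torus_mem[OF assms(3) j(1)] by auto
  have "\<bar>2 * k j - int N\<bar> \<le> int N" "1 \<le> \<bar>2 * k j - int N\<bar>"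
    using kj j(2) by linarith+
  then have *: "\<bar>real_of_int (2 * k j - int N)\<bar> \<le> real N" "1 \<le> \<bar>real_of_int (2 * k j - int N)\<bar>"
    by linarith+
  have "1 \<le> (real_of_int (2 * k j - int N))\<^sup>2"
    using *(2) by (metis abs_1 abs_le_square_iff power_one)
  then have "2 / (real N)\<^sup>2 \<le> 2 * (?t j)\<^sup>2 / pi\<^sup>2"
    using assms(2) by (simp add: power_mult_distrib power_divide divide_right_mono del: of_int_diff)
  also have "\<dots> \<le> 1 - cos (?t j)"
  proof (rule one_minus_cos_ge)
    show "\<bar>?t j\<bar> \<le> pi"
      using * assms(2) by (simp add: abs_mult divide_simps del: of_int_diff)
  qed
  also have "\<dots> \<le> (\<Sum>j<d. 1 - cos (?t j))"
    using j by (intro member_le_sum) auto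
  also have "\<dots> = real d * (1 + eigval d N k)"
    unfolding eigval_def cos_eq using assms by (simp add: sum_subtractf sum_negf field_simps)
  finally have "2 / (real N)\<^sup>2 \<le> (1 + eigval d N k) * real d"
    by (simp only: mult.commute)
  then have "2 / (real N)\<^sup>2 / real d \<le> 1 + eigval d N k"
    using assms by (subst pos_divide_le_eq) auto
  then show ?thesis
    by (simp add: mult.commute)
qed

text \<open>The factor \<open>1 + eigval\<close> vanishes at the parity eigenvalue
  \<open>-1\<close>. Every other eigenvalue has modulus at most \<open>1 - 2 / (d N^2)\<close>, the
  gap at \<open>-1\<close> being estimated more weakly than the gap \<open>8 / (d N^2)\<close> at
  \<open>1\<close>.\<close>

lemma eigval_power_bound:
  assumes "d > 0" "N > 0" "k \<in> torus d N" "k \<noteq> torus_zero d"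
  shows "\<bar>eigval d N k ^ n * (1 + eigval d N k)\<bar> \<le> 2 * exp (- (2 * real n / (real d * (real N)\<^sup>2)))"
proof (cases "eigval d N k = -1")
  case False
  let ?e = "2 / (real d * (real N)\<^sup>2)"
  have "8 * 1 / (real d * (real N)\<^sup>2) \<le> 8 * (\<Sum>j<d. (cyc_norm N (k j))\<^sup>2) / (real d * (real N)\<^sup>2)"
    by (intro divide_right_mono mult_left_mono sum_cyc_norm_ge_1 assms) auto
  also have "\<dots> \<le> 1 - eigval d N k"
    using assms by (intro one_minus_eigval_ge)
  finally have "8 / (real d * (real N)\<^sup>2) \<le> 1 - eigval d N k"
    by simp
  moreover have "?e \<le> 8 / (real d * (real N)\<^sup>2)"
    by (intro divide_right_mono) auto
  ultimately have "?e \<le> 1 - eigval d N k"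
    by (rule order_trans[rotated])
  then have "\<bar>eigval d N k\<bar> \<le> 1 - ?e"
    using one_plus_eigval_ge[OF assms(1-3) False] unfolding abs_le_iff by argo
  also have "\<dots> \<le> exp (- ?e)"
    using exp_ge_add_one_self[of "- ?e"] by simp
  finally have "\<bar>eigval d N k\<bar> ^ n \<le> exp (- ?e) ^ n"
    by (intro power_mono) auto
  moreover have "\<bar>1 + eigval d N k\<bar> \<le> 2"
    using abs_eigval_le_1[of d N k] by linarith
  ultimately have "\<bar>eigval d N k\<bar> ^ n * \<bar>1 + eigval d N k\<bar> \<le> exp (- ?e) ^ n * 2"
    by (intro mult_mono) auto
  then show ?thesis
    by (simp add: abs_mult power_abs exp_of_nat_mult[symmetric] mult_ac)
qed auto

text \<open>Adding two consecutive times cancels the oscillation of the parity.\<close>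

lemma heat_mixing:
  assumes "d > 0" "N > 0" "z \<in> torus d N" "x \<in> torus d N"
  shows "\<bar>heat d N n z x + heat d N (Suc n) z x - 2 / real N ^ d\<bar>
    \<le> 2 * exp (- (2 * real n / (real d * (real N)\<^sup>2)))"
proof -
  let ?B = "2 * exp (- (2 * real n / (real d * (real N)\<^sup>2)))"
  let ?f = "\<lambda>k. complex_of_real (eigval d N k ^ n * (1 + eigval d N k)) * (tchar d N k z * cnj (tchar d N k x))"
  let ?T = "torus d N - {torus_zero d}"
  have "complex_of_real (heat d N n z x + heat d N (Suc n) z x) = (\<Sum>k\<in>torus d N. ?f k) / of_nat N ^ d"
    unfolding of_real_add heat_Fourier[OF assms(2,1,3,4)]
    by (simp add: add_divide_distrib[symmetric] sum.distrib[symmetric] algebra_simps)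
  also have "(\<Sum>k\<in>torus d N. ?f k) = 2 + (\<Sum>k\<in>?T. ?f k)"
    using assms by (subst sum.remove[of _ "torus_zero d"]) (auto simp: torus_zero_in_torus eigval_torus_zero tchar_torus_zero)
  finally have "complex_of_real (heat d N n z x + heat d N (Suc n) z x - 2 / real N ^ d)
      = (\<Sum>k\<in>?T. ?f k) / of_nat N ^ d"
    by (simp add: add_divide_distrib)
  from arg_cong[OF this, of norm]
  have "\<bar>heat d N n z x + heat d N (Suc n) z x - 2 / real N ^ d\<bar> = norm (\<Sum>k\<in>?T. ?f k) / real N ^ d"
    by (simp only: norm_of_real norm_divide norm_power norm_of_nat)
  also have "\<dots> \<le> (\<Sum>k\<in>?T. ?B) / real N ^ d"
  proof (intro divide_right_mono sum_norm_le)
    fix k assume "k \<in> ?T"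
    then show "norm (?f k) \<le> ?B"
      using eigval_power_bound[of d N k n] assms unfolding norm_mult norm_of_real complex_mod_cnj norm_tchar by simp
  qed auto
  \<comment> \<open>There are at most \<open>N^d\<close> frequencies, which cancels the
    normalisation. The exponential alone must then beat \<open>N^(-d)\<close>, hence the logarithm
    in the mixing time.\<close>
  also have "\<dots> \<le> (real (card (torus d N)) * ?B) / real N ^ d"
    by (intro divide_right_mono) (auto intro!: mult_right_mono card_mono simp: card_Diff_subset_Int)
  also have "\<dots> = ?B"
    using assms by (simp add: card_torus)
  finally show ?thesis .
qed

section \<open>Power sums over the frequencies and the Green function\<close>

lemma sum_powr_le:
  assumes "0 \<le> s" "s < 1"
  shows "(\<Sum>m=1..n. real m powr (- s)) \<le> real n powr (1 - s) / (1 - s)"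
proof (induction n)
  case (Suc n)
  have "(1 - s) * real (Suc n) powr (- s) \<le> real (Suc n) powr (1 - s) - real n powr (1 - s)"
  \<comment> \<open>Comparison with the integral of \<open>t powr (-s)\<close>, one increment at a
    time by the mean value theorem. The first increment is separate because
    \<open>t powr (1 - s)\<close> need not be differentiable at \<open>0\<close>.\<close>
  proof (cases "n = 0")
    case False
    have "\<exists>z. real n < z \<and> z < real (Suc n) \<and>
        real (Suc n) powr (1 - s) - real n powr (1 - s) = (real (Suc n) - real n) * ((1 - s) * z powr (1 - s - 1))"
      using False by (intro MVT2) (auto intro!: derivative_eq_intros)
    then obtain z where z: "real n < z" "z < real (Suc n)"
        "real (Suc n) powr (1 - s) - real n powr (1 - s) = (1 - s) * z powr (- s)"
      by auto
    have "real (Suc n) powr (- s) \<le> z powr (- s)"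
      using z assms by (intro powr_mono2') auto
    then show ?thesis
      unfolding z(3) using assms by (intro mult_left_mono) auto
  qed (use assms in auto)
  then have "real (Suc n) powr (- s) \<le> (real (Suc n) powr (1 - s) - real n powr (1 - s)) / (1 - s)"
    using assms by (simp add: pos_le_divide_eq mult.commute)
  with Suc show ?case
    by (simp add: diff_divide_distrib)
qed auto

text \<open>A nonzero residue lies at distance \<open>m\<close> or \<open>N - m\<close> from
  \<open>0\<close>, so two copies of the power sum dominate. The exponent will be
  \<open>s = 2 / d\<close>, at most \<open>2/3\<close> for \<open>d \<ge> 3\<close>; then
  \<open>1 / (1 - s) \<le> 3\<close>, and \<open>7 = 1 + 3 + 3\<close> with the \<open>1\<close>
  from \<open>m = 0\<close>.\<close>

lemma sum_cyc_norm_powr_le: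
  assumes "0 \<le> s" "s \<le> 2/3" "N > 0"
  shows "(\<Sum>m\<in>{0..<int N}. max 1 (cyc_norm N m) powr (- s)) \<le> 7 * real N powr (1 - s)"
proof -
  let ?S = "\<Sum>m=1..N. real m powr (- s)"
  have bij: "bij_betw int {..<N} {0..<int N}"
    by (auto simp: bij_betw_def inj_on_def image_int_atLeastLessThan lessThan_atLeast0)
  have "(\<Sum>m\<in>{0..<int N}. max 1 (cyc_norm N m) powr (- s)) = (\<Sum>m<N. max 1 (cyc_norm N (int m)) powr (- s))"
    by (rule sum.reindex_bij_betw[OF bij, symmetric])
  also have "\<dots> = 1 + (\<Sum>m\<in>{1..<N}. max 1 (cyc_norm N (int m)) powr (- s))"
    using assms by (subst sum.remove[of _ 0]) (auto simp: cyc_norm_def max_def intro!: sum.cong)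
  also have "(\<Sum>m\<in>{1..<N}. max 1 (cyc_norm N (int m)) powr (- s))
      \<le> (\<Sum>m\<in>{1..<N}. real m powr (- s) + real (N - m) powr (- s))"
  proof (rule sum_mono)
    fix m assume "m \<in> {1..<N}"
    then have "max 1 (cyc_norm N (int m)) = real m \<or> max 1 (cyc_norm N (int m)) = real (N - m)"
      by (auto simp: cyc_norm_def min_def of_nat_diff)
    then show "max 1 (cyc_norm N (int m)) powr (- s) \<le> real m powr (- s) + real (N - m) powr (- s)"
      by (elim disjE) auto
  qed
  also have "\<dots> = (\<Sum>m\<in>{1..<N}. real m powr (- s)) + (\<Sum>m\<in>{1..<N}. real (N - m) powr (- s))"
    by (rule sum.distrib)
  also have "(\<Sum>m\<in>{1..<N}. real (N - m) powr (- s)) = (\<Sum>m\<in>{1..<N}. real m powr (- s))"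
    by (rule sum.reindex_bij_witness[of _ "\<lambda>m. N - m" "\<lambda>m. N - m"]) auto
  also have "(\<Sum>m\<in>{1..<N}. real m powr (- s)) \<le> ?S"
    by (intro sum_mono2) auto
  also have "?S \<le> real N powr (1 - s) / (1 - s)"
    using assms by (intro sum_powr_le) auto
  also have "\<dots> \<le> 3 * real N powr (1 - s)"
  proof -
    have "real N powr (1 - s) * 1 \<le> real N powr (1 - s) * (3 * (1 - s))"
      using assms by (intro mult_left_mono) auto
    then show ?thesis
      using assms by (simp add: divide_simps mult_ac)
  qed
  also have "1 + (3 * real N powr (1 - s) + 3 * real N powr (1 - s)) \<le> 7 * real N powr (1 - s)"
    using assms ge_one_powr_ge_zero[of "real N" "1 - s"] by simp
  finally show ?thesis
    by simp
qed

text \<open>The first factor is the loss in \<open>inverse_gap_le\<close>; each coordinate adds a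
  \<open>7\<close> from \<open>sum_cyc_norm_powr_le\<close>.\<close>

definition green_const :: "nat \<Rightarrow> real" where
  "green_const d = real d * (real d + 1) / 4 * 7 ^ d"

text \<open>With \<open>a\<^sub>j = max 1 (cyc_norm N (k j))\<close>, replacing \<open>\<Sum>j. a\<^sub>j\<^sup>2\<close> by the smaller
  \<open>\<Prod>j. a\<^sub>j powr (2/d)\<close> makes the sum over frequencies factorise into one-dimensional sums.\<close>

lemma inverse_gap_le:
  assumes "d > 0" "N > 0" "k \<in> torus d N" "k \<noteq> torus_zero d"
  shows "eigval d N k < 1"
    and "2 / (1 - eigval d N k) \<le> real d * (real d + 1) / 4 * (real N)\<^sup>2
      * (\<Prod>j<d. max 1 (cyc_norm N (k j)) powr (- (2 / real d)))"
proof -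
  define W where "W = (\<Sum>j<d. (cyc_norm N (k j))\<^sup>2)"
  define A where "A = (\<Sum>j<d. (max 1 (cyc_norm N (k j)))\<^sup>2)"
  define Q where "Q = (\<Prod>j<d. max 1 (cyc_norm N (k j)) powr (2 / real d))"
  have W: "W \<ge> 1"
    unfolding W_def by (rule sum_cyc_norm_ge_1) fact+
  have gap: "8 * W / (real d * (real N)\<^sup>2) \<le> 1 - eigval d N k"
    unfolding W_def using assms by (intro one_minus_eigval_ge)
  have pos: "8 * W / (real d * (real N)\<^sup>2) > 0"
    using W assms by simp
  with gap show "eigval d N k < 1"
    by linarith
  \<comment> \<open>Truncation at \<open>1\<close> keeps \<open>Q\<close> positive when some
    coordinates vanish. As \<open>W \<ge> 1\<close>, it costs only a factor
    \<open>d + 1\<close>.\<close>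
  have "A \<le> (\<Sum>j<d. 1 + (cyc_norm N (k j))\<^sup>2)"
    unfolding A_def by (intro sum_mono) (auto simp: max_def)
  also have "\<dots> = real d + W"
    by (simp add: sum.distrib W_def)
  also have "\<dots> \<le> (real d + 1) * W"
    using W mult_left_mono[of 1 W "real d"] by (simp add: algebra_simps)
  finally have A: "A \<le> (real d + 1) * W" .
  have "1 \<le> (max 1 (cyc_norm N (k 0)))\<^sup>2"
    by (rule one_le_power) simp
  also have "\<dots> \<le> A"
    unfolding A_def using assms by (intro member_le_sum) auto
  finally have A1: "A \<ge> 1" .
  \<comment> \<open>Each \<open>a\<^sub>j^2\<close> is at most \<open>A\<close>, so the product of
    their \<open>d\<close>-th roots is at most \<open>A\<close>.\<close>
  have "Q \<le> (\<Prod>j<d. A powr (1 / real d))"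
    unfolding Q_def
  proof (intro prod_mono conjI)
    fix j assume "j \<in> {..<d}"
    then have "(max 1 (cyc_norm N (k j)))\<^sup>2 \<le> A"
      unfolding A_def by (intro member_le_sum) auto
    then have "((max 1 (cyc_norm N (k j)))\<^sup>2) powr (1 / real d) \<le> A powr (1 / real d)"
      by (intro powr_mono2) auto
    also have "((max 1 (cyc_norm N (k j)))\<^sup>2) powr (1 / real d) = max 1 (cyc_norm N (k j)) powr (2 / real d)"
      using powr_powr[of "max 1 (cyc_norm N (k j))" 2 "1 / real d"] by simp
    finally show "max 1 (cyc_norm N (k j)) powr (2 / real d) \<le> A powr (1 / real d)" .
  qed auto
  also have "\<dots> = A"
    using A1 assms by (simp add: powr_realpow[symmetric] powr_powr)
  finally have "Q \<le> (real d + 1) * W"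
    using A by simp
  moreover have Q: "Q > 0"
    unfolding Q_def by (intro prod_pos) auto
  ultimately have "1 / W \<le> (real d + 1) / Q"
    using W by (simp add: divide_simps mult.commute)
  have "2 / (1 - eigval d N k) \<le> 2 / (8 * W / (real d * (real N)\<^sup>2))"
    using gap pos by (intro divide_left_mono mult_pos_pos) auto
  also have "\<dots> = real d * (real N)\<^sup>2 / 4 * (1 / W)"
    by simp
  also have "\<dots> \<le> real d * (real N)\<^sup>2 / 4 * ((real d + 1) / Q)"
    by (intro mult_left_mono) (fact, simp)
  also have "\<dots> = real d * (real d + 1) / 4 * (real N)\<^sup>2 * inverse Q"
    by (simp add: field_simps)
  also have "inverse Q = (\<Prod>j<d. max 1 (cyc_norm N (k j)) powr (- (2 / real d)))"
    unfolding Q_def by (simp add: powr_minus prod_inversef[symmetric])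
  finally show "2 / (1 - eigval d N k) \<le> real d * (real d + 1) / 4 * (real N)\<^sup>2
      * (\<Prod>j<d. max 1 (cyc_norm N (k j)) powr (- (2 / real d)))" .
qed

text \<open>The powers balance: \<open>N^2\<close> from the gap times the \<open>d\<close>-th power
  of \<open>N powr (1 - 2/d)\<close> is \<open>N^d\<close>. This is transience in quantitative form;
  at \<open>d = 2\<close> the one-dimensional sums would diverge logarithmically.\<close>

lemma sum_inverse_gap_le:
  assumes "d \<ge> 3" "N > 0"
  shows "(\<Sum>k\<in>torus d N - {torus_zero d}. 2 / (1 - eigval d N k)) \<le> green_const d * real N ^ d"
proof -
  let ?g = "\<lambda>m. max 1 (cyc_norm N m) powr (- (2 / real d))"
  let ?c = "real d * (real d + 1) / 4 * (real N)\<^sup>2"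
  have "(\<Sum>k\<in>torus d N - {torus_zero d}. 2 / (1 - eigval d N k))
      \<le> (\<Sum>k\<in>torus d N - {torus_zero d}. ?c * (\<Prod>j<d. ?g (k j)))"
    using assms by (intro sum_mono inverse_gap_le) auto
  also have "\<dots> \<le> (\<Sum>k\<in>torus d N. ?c * (\<Prod>j<d. ?g (k j)))"
    by (intro sum_mono2) (auto intro!: mult_nonneg_nonneg prod_nonneg)
  also have "\<dots> = ?c * (\<Prod>j<d. \<Sum>m\<in>{0..<int N}. ?g m)"
    unfolding sum_distrib_left[symmetric] torus_def by (subst prod_sum_PiE) auto
  also have "\<dots> \<le> ?c * (\<Prod>j<d. 7 * real N powr (1 - 2 / real d))"
    using assms by (intro mult_left_mono prod_mono conjI sum_nonneg sum_cyc_norm_powr_le) (auto simp: divide_simps)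
  also have "(\<Prod>j<d. 7 * real N powr (1 - 2 / real d)) = 7 ^ d * real N powr (real d - 2)"
    using assms by (simp add: power_mult_distrib powr_realpow[symmetric] powr_powr algebra_simps)
  also have "real N powr (real d - 2) = real N ^ d / (real N)\<^sup>2"
    using assms by (simp add: powr_diff powr_realpow)
  also have "?c * (7 ^ d * (real N ^ d / (real N)\<^sup>2)) = green_const d * real N ^ d"
    using assms by (simp add: green_const_def)
  finally show ?thesis .
qed

text \<open>The zero frequency contributes the stationary part \<open>n / N^d\<close>; at any other
  one the geometric sum is at most \<open>2 / (1 - eigval)\<close>, whatever \<open>n\<close>
  is.\<close>

lemma green_bound:
  assumes "d \<ge> 3" "N > 0" "x \<in> torus d N"
  shows "(\<Sum>i<n. heat d N i x x) \<le> real n / real N ^ d + green_const d"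
proof -
  let ?T = "torus d N - {torus_zero d}"
  have d: "d > 0"
    using assms by simp
  have "heat d N i x x = (\<Sum>k\<in>torus d N. eigval d N k ^ i) / real N ^ d" for i
  proof -
    have "tchar d N k x * cnj (tchar d N k x) = 1" for k
      by (simp add: complex_norm_square[symmetric])
    then have "complex_of_real (heat d N i x x) = of_real ((\<Sum>k\<in>torus d N. eigval d N k ^ i) / real N ^ d)"
      unfolding heat_Fourier[OF assms(2) d assms(3,3)] by simp
    then show ?thesis
      by (simp only: of_real_eq_iff)
  qed
  then have "(\<Sum>i<n. heat d N i x x) = (\<Sum>i<n. \<Sum>k\<in>torus d N. eigval d N k ^ i) / real N ^ d"
    by (simp add: sum_divide_distrib)
  also have "(\<Sum>i<n. \<Sum>k\<in>torus d N. eigval d N k ^ i) = (\<Sum>k\<in>torus d N. \<Sum>i<n. eigval d N k ^ i)"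
    by (rule sum.swap)
  also have "(\<Sum>k\<in>torus d N. \<Sum>i<n. eigval d N k ^ i) = real n + (\<Sum>k\<in>?T. \<Sum>i<n. eigval d N k ^ i)"
    using assms d by (subst sum.remove[of _ "torus_zero d"]) (auto simp: torus_zero_in_torus eigval_torus_zero)
  also have "(\<Sum>k\<in>?T. \<Sum>i<n. eigval d N k ^ i) \<le> (\<Sum>k\<in>?T. 2 / (1 - eigval d N k))"
  proof (rule sum_mono)
    fix k assume "k \<in> ?T"
    then have less: "eigval d N k < 1"
      using inverse_gap_le(1)[of d N k] assms d by auto
    have "\<bar>eigval d N k ^ n\<bar> \<le> 1"
      using abs_eigval_le_1[of d N k] by (simp add: power_abs power_le_one)
    then have "(1 - eigval d N k ^ n) / (1 - eigval d N k) \<le> 2 / (1 - eigval d N k)"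
      using less by (intro divide_right_mono) auto
    then show "(\<Sum>i<n. eigval d N k ^ i) \<le> 2 / (1 - eigval d N k)"
      using less by (simp add: sum_gp_strict)
  qed
  also have "\<dots> \<le> green_const d * real N ^ d"
    by (rule sum_inverse_gap_le) fact+
  finally show ?thesis
    using assms by (simp add: add_divide_distrib divide_right_mono)
qed

section \<open>Hitting probabilities\<close>

text \<open>The endpoint is left out, since it is the first position of the next block:
  \<open>n\<close> directions account for times \<open>0, ..., n - 1\<close>, and blocks concatenate
  in \<open>vis_append\<close> without counting a time twice.\<close>

primrec vis :: "nat \<Rightarrow> (nat \<Rightarrow> int) \<Rightarrow> (nat \<times> int) list \<Rightarrow> (nat \<Rightarrow> int) set" where
  "vis N z [] = {}"
| "vis N z (v # vs) = insert z (vis N (torus_step N z v) vs)"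

lemma vis_append: "vis N z (us @ vs) = vis N z us \<union> vis N (foldl (torus_step N) z us) vs"
  by (induction us arbitrary: z) auto

lemma finite_vis [simp]: "finite (vis N z vs)"
  by (induction vs arbitrary: z) auto

lemma card_vis_le: "card (vis N z vs) \<le> length vs"
  by (induction vs arbitrary: z) (auto intro!: card_insert_le_m1)

definition hit :: "nat \<Rightarrow> nat \<Rightarrow> nat \<Rightarrow> (nat \<Rightarrow> int) \<Rightarrow> (nat \<Rightarrow> int) \<Rightarrow> real" where
  "hit d N n z x = dir_avg d n (\<lambda>vs. of_bool (x \<in> vis N z vs))"

lemma hit_0: "hit d N 0 z x = 0"
  by (simp add: hit_def)

lemma hit_Suc:
  assumes "d > 0"
  shows "hit d N (Suc n) z x = (if z = x then 1 else (\<Sum>v\<in>directions d. hit d N n (torus_step N z v) x) / (2 * real d))"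
  using assms by (auto simp: hit_def dir_avg_const)

text \<open>A union bound: the right-hand side is the expected number of visits. Both sides are
  expanded at the first step.\<close>

lemma hit_le_sum_heat:
  assumes "d > 0"
  shows "hit d N n z x \<le> (\<Sum>i<n. heat d N i z x)"
proof (induction n arbitrary: z)
  case (Suc n)
  have eq: "(\<Sum>i<Suc n. heat d N i z x) = of_bool (z = x) + (\<Sum>v\<in>directions d. \<Sum>i<n. heat d N i (torus_step N z v) x) / (2 * real d)"
    unfolding sum.lessThan_Suc_shift heat_0 heat_Suc sum_divide_distrib[symmetric] by (subst sum.swap) simp
  have "(\<Sum>v\<in>directions d. hit d N n (torus_step N z v) x) / (2 * real d)
      \<le> (\<Sum>v\<in>directions d. \<Sum>i<n. heat d N i (torus_step N z v) x) / (2 * real d)"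
    by (intro divide_right_mono sum_mono Suc) simp
  moreover have "(\<Sum>v\<in>directions d. \<Sum>i<n. heat d N i (torus_step N z v) x) / (2 * real d) \<ge> 0"
    using assms by (intro divide_nonneg_nonneg sum_nonneg heat_nonneg) auto
  ultimately show ?case
    unfolding eq hit_Suc[OF assms] by (cases "z = x") simp_all
qed (simp add: hit_0)

text \<open>First-passage decomposition: once \<open>x\<close> is reached, at most \<open>G\<close> visits are expected.\<close>

lemma sum_heat_le_hit:
  assumes "d > 0" "(\<Sum>i<n. heat d N i x x) \<le> G"
  shows "(\<Sum>i<n. heat d N i z x) \<le> G * hit d N n z x"
  using assms(2)
proof (induction n arbitrary: z)
  case (Suc n)
  have le: "(\<Sum>i<n. heat d N i x x) \<le> G"
    using Suc.prems heat_nonneg[OF assms(1), of N n x x] by simp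
  show ?case
  proof (cases "z = x")
    case False
    have "(\<Sum>i<Suc n. heat d N i z x) = (\<Sum>v\<in>directions d. \<Sum>i<n. heat d N i (torus_step N z v) x) / (2 * real d)"
      unfolding sum.lessThan_Suc_shift heat_0 heat_Suc sum_divide_distrib[symmetric]
      using False by (subst sum.swap) simp
    also have "\<dots> \<le> (\<Sum>v\<in>directions d. G * hit d N n (torus_step N z v) x) / (2 * real d)"
      by (intro divide_right_mono sum_mono Suc.IH le) simp
    also have "\<dots> = G * hit d N (Suc n) z x"
      using False assms by (simp add: hit_Suc sum_distrib_left)
    finally show ?thesis .
  qed (use Suc.prems assms in \<open>simp add: hit_Suc\<close>)
qed (simp add: hit_0)

text \<open>The effect of one block. The term linear in the centred variable averages to zero, so
  only the squared deviation is added. The factor \<open>c\<close> will be \<open>(1 - a)^k\<close>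
  or \<open>-((1 - b)^k)\<close>, the decay in the blocks still to come.\<close>

lemma dir_avg_pos_part_square:
  assumes "d > 0" "\<bar>c\<bar> \<le> 1"
    and "\<And>vs. length vs = n \<Longrightarrow> set vs \<subseteq> directions d \<Longrightarrow> \<bar>F vs - dir_avg d n F\<bar> \<le> \<delta>"
  shows "dir_avg d n (\<lambda>vs. (max 0 (c * F vs + s))\<^sup>2) \<le> (max 0 (c * dir_avg d n F + s))\<^sup>2 + \<delta>\<^sup>2"
proof -
  define \<mu> where "\<mu> = dir_avg d n F"
  define p where "p = c * \<mu> + s"
  \<comment> \<open>A first-order Taylor bound: \<open>(max 0 p)^2\<close> has derivative
    \<open>2 * max 0 p\<close>, whose slope is at most \<open>2\<close>.\<close>
  have square: "(max 0 (p + w))\<^sup>2 \<le> (max 0 p)\<^sup>2 + 2 * max 0 p * w + w\<^sup>2" for w :: real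
  proof (cases "p \<ge> 0")
    case True
    have "(max 0 (p + w))\<^sup>2 \<le> (p + w)\<^sup>2"
      by (auto simp: max_def)
    with True show ?thesis
      by (simp add: power2_sum)
  next
    case False
    then have "(max 0 (p + w))\<^sup>2 \<le> \<bar>w\<bar>\<^sup>2"
      by (intro power_mono) auto
    with False show ?thesis
      by simp
  qed
  have "dir_avg d n (\<lambda>vs. (max 0 (c * F vs + s))\<^sup>2)
      \<le> dir_avg d n (\<lambda>vs. ((max 0 p)\<^sup>2 + \<delta>\<^sup>2) + 2 * max 0 p * c * (F vs - \<mu>))"
  proof (rule dir_avg_mono)
    fix vs assume vs: "length vs = n" "set vs \<subseteq> directions d"
    have "\<bar>c * (F vs - \<mu>)\<bar> \<le> 1 * \<delta>"
      unfolding abs_mult \<mu>_def using assms vs by (intro mult_mono) auto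
    then have "(c * (F vs - \<mu>))\<^sup>2 \<le> \<delta>\<^sup>2"
      by (simp add: abs_le_square_iff[symmetric])
    moreover have "c * F vs + s = p + c * (F vs - \<mu>)"
      by (simp add: p_def algebra_simps)
    ultimately show "(max 0 (c * F vs + s))\<^sup>2 \<le> ((max 0 p)\<^sup>2 + \<delta>\<^sup>2) + 2 * max 0 p * c * (F vs - \<mu>)"
      using square[of "c * (F vs - \<mu>)"] by (simp add: mult.assoc)
  qed
  also have "\<dots> = (max 0 p)\<^sup>2 + \<delta>\<^sup>2"
    unfolding dir_avg_add dir_avg_cmult dir_avg_diff dir_avg_const[OF assms(1)] by (simp add: \<mu>_def)
  finally show ?thesis
    by (simp add: p_def \<mu>_def)
qed

lemma Chebyshev_square:
  assumes "\<epsilon> > 0"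
  shows "dir_avg d n (\<lambda>vs. of_bool (F vs > \<epsilon>)) \<le> dir_avg d n (\<lambda>vs. (max 0 (F vs))\<^sup>2) / \<epsilon>\<^sup>2"
proof -
  have "\<epsilon>\<^sup>2 * dir_avg d n (\<lambda>vs. of_bool (F vs > \<epsilon>)) \<le> dir_avg d n (\<lambda>vs. (max 0 (F vs))\<^sup>2)"
    unfolding dir_avg_cmult[symmetric] using assms by (intro dir_avg_mono) (auto intro!: power_mono)
  then show ?thesis
    using assms by (simp add: pos_le_divide_eq mult.commute)
qed

section \<open>Block decomposition\<close>

text \<open>The path is cut into blocks, each consisting of \<open>\<tau>\<close> steps during which the walk mixes and a
  window of \<open>2 * l\<close> steps.\<close>

locale block_walk =
  fixes d N \<tau> l :: nat and G :: real
  assumes d: "d > 0" and N: "N > 0" and G: "G > 0"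
    and heat_bounds: "\<And>z x n. z \<in> torus d N \<Longrightarrow> x \<in> torus d N \<Longrightarrow> n \<ge> \<tau> \<Longrightarrow>
      1 / real N ^ d \<le> heat d N n z x + heat d N (Suc n) z x \<and>
      heat d N n z x + heat d N (Suc n) z x \<le> 3 / real N ^ d"
    and green: "\<And>x. x \<in> torus d N \<Longrightarrow> (\<Sum>i<2 * l. heat d N i x x) \<le> G"
begin

definition M :: nat where "M = \<tau> + 2 * l"
definition \<delta> :: real where "\<delta> = real M / real N ^ d"
definition \<gamma> :: real where "\<gamma> = real \<tau> / real N ^ d"
text \<open>\<open>a\<close> and \<open>b\<close> will bound the probability that a given point is
  visited in the window. Its \<open>l\<close> pairs of times each carry heat between
  \<open>1 / N^d\<close> and \<open>3 / N^d\<close>; dividing by \<open>G\<close> passes from visits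
  to hits.\<close>

definition a :: real where "a = real l / (G * real N ^ d)"
definition b :: real where "b = 3 * real l / real N ^ d"

abbreviation pos :: "(nat \<Rightarrow> int) \<Rightarrow> (nat \<times> int) list \<Rightarrow> nat \<Rightarrow> int" where
  "pos \<equiv> foldl (torus_step N)"

abbreviation dens :: "(nat \<Rightarrow> int) set \<Rightarrow> real" where
  "dens V \<equiv> real (card V) / real N ^ d"

lemma sum_heat_window:
  assumes "z \<in> torus d N" "x \<in> torus d N"
  shows "real m / real N ^ d \<le> (\<Sum>i<2 * m. heat d N (\<tau> + i) z x)"
    and "(\<Sum>i<2 * m. heat d N (\<tau> + i) z x) \<le> 3 * real m / real N ^ d"
proof (induction m)
  case (Suc m)
  { case 1
    show ?case
      using Suc(1) heat_bounds[OF assms, of "\<tau> + 2 * m"] by (simp add: add_divide_distrib) }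
  { case 2
    show ?case
      using Suc(2) heat_bounds[OF assms, of "\<tau> + 2 * m"] by (simp add: add_divide_distrib) }
qed auto

text \<open>After the mixing steps the expected number of visits is controlled by
  \<open>sum_heat_window\<close>. The hitting probability is at most this number, and at least its
  \<open>G\<close>-th part by \<open>sum_heat_le_hit\<close>.\<close>

lemma hit_window:
  assumes "z \<in> torus d N" "x \<in> torus d N"
  shows "a \<le> dir_avg d \<tau> (\<lambda>us. hit d N (2 * l) (pos z us) x)"
    and "dir_avg d \<tau> (\<lambda>us. hit d N (2 * l) (pos z us) x) \<le> b"
proof -
  let ?H = "dir_avg d \<tau> (\<lambda>us. hit d N (2 * l) (pos z us) x)"
  have eq: "dir_avg d \<tau> (\<lambda>us. \<Sum>i<2 * l. heat d N i (pos z us) x) = (\<Sum>i<2 * l. heat d N (\<tau> + i) z x)"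
    by (simp add: dir_avg_sum heat_add)
  have "?H \<le> dir_avg d \<tau> (\<lambda>us. \<Sum>i<2 * l. heat d N i (pos z us) x)"
    by (intro dir_avg_mono hit_le_sum_heat d)
  with sum_heat_window(2)[OF assms, of l] show "?H \<le> b"
    unfolding eq b_def by linarith
  have "dir_avg d \<tau> (\<lambda>us. \<Sum>i<2 * l. heat d N i (pos z us) x) \<le> dir_avg d \<tau> (\<lambda>us. G * hit d N (2 * l) (pos z us) x)"
    by (intro dir_avg_mono sum_heat_le_hit d green assms)
  then have "real l / real N ^ d \<le> G * ?H"
    using sum_heat_window(1)[OF assms, of l] unfolding eq dir_avg_cmult by linarith
  then have "real l / real N ^ d / G \<le> ?H"
    by (subst pos_divide_le_eq[OF G]) (simp only: mult.commute)
  then show "a \<le> ?H"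
    by (simp add: a_def mult.commute)
qed

lemma dir_avg_card_vis:
  assumes "finite V"
  shows "dir_avg d (2 * l) (\<lambda>vs. real (card (V \<inter> vis N y vs))) = (\<Sum>x\<in>V. hit d N (2 * l) y x)"
proof -
  have "real (card (V \<inter> vis N y vs)) = (\<Sum>x\<in>V. of_bool (x \<in> vis N y vs))" for vs
    using assms by (simp add: sum.If_cases of_bool_def)
  then show ?thesis
    by (simp add: dir_avg_sum hit_def)
qed

text \<open>Linearity computes the expected removal by the window alone. Removals during the mixing
  steps are ignored in the upper bound and charged as \<open>\<tau>\<close> points in the lower
  one.\<close>

lemma block_mean:
  assumes "z \<in> torus d N" "V \<subseteq> torus d N"
  shows "dir_avg d M (\<lambda>vs. dens (V - vis N z vs)) \<le> (1 - a) * dens V"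
    and "(1 - b) * dens V - \<gamma> \<le> dir_avg d M (\<lambda>vs. dens (V - vis N z vs))"
proof -
  have fin: "finite V"
    using assms(2) finite_torus finite_subset by blast
  define H where "H = dir_avg d \<tau> (\<lambda>us. dir_avg d (2 * l) (\<lambda>vs. real (card (V \<inter> vis N (pos z us) vs))))"
  have "H = (\<Sum>x\<in>V. dir_avg d \<tau> (\<lambda>us. hit d N (2 * l) (pos z us) x))"
    unfolding H_def dir_avg_card_vis[OF fin] by (rule dir_avg_sum)
  moreover have "(\<Sum>x\<in>V. a) \<le> (\<Sum>x\<in>V. dir_avg d \<tau> (\<lambda>us. hit d N (2 * l) (pos z us) x))"
    using assms by (intro sum_mono hit_window) auto
  moreover have "(\<Sum>x\<in>V. dir_avg d \<tau> (\<lambda>us. hit d N (2 * l) (pos z us) x)) \<le> (\<Sum>x\<in>V. b)"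
    using assms by (intro sum_mono hit_window) auto
  ultimately have H: "real (card V) * a \<le> H" "H \<le> real (card V) * b"
    by auto
  have P: "real N ^ d > 0"
    using N by simp
  have eq: "dir_avg d M (\<lambda>vs. dens (V - vis N z vs))
      = dir_avg d \<tau> (\<lambda>us. dir_avg d (2 * l) (\<lambda>vs. dens (V - vis N z (us @ vs))))"
    unfolding M_def by (rule dir_avg_append)
  have up: "dens (V - vis N z (us @ vs)) \<le> dens V - 1 / real N ^ d * real (card (V \<inter> vis N (pos z us) vs))" for us vs
  proof -
    have "card (V - vis N z (us @ vs)) \<le> card (V - vis N (pos z us) vs)"
      using fin by (intro card_mono) (auto simp: vis_append)
    also have "card (V - vis N (pos z us) vs) = card V - card (V \<inter> vis N (pos z us) vs)"
      using fin by (simp add: card_Diff_subset_Int)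
    also have "real (card V - card (V \<inter> vis N (pos z us) vs)) = real (card V) - real (card (V \<inter> vis N (pos z us) vs))"
      using fin by (intro of_nat_diff card_mono) auto
    finally have "real (card (V - vis N z (us @ vs))) \<le> real (card V) - real (card (V \<inter> vis N (pos z us) vs))"
      by simp
    then show ?thesis
      using P by (simp add: divide_right_mono diff_divide_distrib[symmetric])
  qed
  have lo: "dens V - 1 / real N ^ d * real (card (V \<inter> vis N (pos z us) vs)) - \<gamma> \<le> dens (V - vis N z (us @ vs))"
    if "length us = \<tau>" for us vs
  proof -
    have "card V \<le> card ((V - vis N z (us @ vs)) \<union> vis N z us \<union> (V \<inter> vis N (pos z us) vs))"
      using fin by (intro card_mono) (auto simp: vis_append)
    also have "\<dots> \<le> card (V - vis N z (us @ vs)) + card (vis N z us) + card (V \<inter> vis N (pos z us) vs)"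
      by (meson add_mono_thms_linordered_semiring(3) card_Un_le order_trans)
    also have "card (vis N z us) \<le> \<tau>"
      using card_vis_le[of N z us] that by simp
    finally have "real (card V) - real (card (V \<inter> vis N (pos z us) vs)) - real \<tau> \<le> real (card (V - vis N z (us @ vs)))"
      by linarith
    then show ?thesis
      using P by (simp add: \<gamma>_def divide_right_mono diff_divide_distrib[symmetric])
  qed
  have "dir_avg d M (\<lambda>vs. dens (V - vis N z vs))
      \<le> dir_avg d \<tau> (\<lambda>us. dir_avg d (2 * l) (\<lambda>vs. dens V - 1 / real N ^ d * real (card (V \<inter> vis N (pos z us) vs))))"
    unfolding eq by (intro dir_avg_mono up)
  also have "\<dots> = dens V - 1 / real N ^ d * H"
    unfolding dir_avg_diff dir_avg_cmult dir_avg_const[OF d] H_def ..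
  also have "\<dots> \<le> dens V - 1 / real N ^ d * (real (card V) * a)"
    using H(1) P by (intro diff_left_mono mult_left_mono) auto
  finally show "dir_avg d M (\<lambda>vs. dens (V - vis N z vs)) \<le> (1 - a) * dens V"
    by (simp add: algebra_simps diff_divide_distrib)
  have "dens V - 1 / real N ^ d * (real (card V) * b) - \<gamma> \<le> dens V - 1 / real N ^ d * H - \<gamma>"
    using H(2) P by (intro diff_right_mono diff_left_mono mult_left_mono) auto
  also have "\<dots> = dir_avg d \<tau> (\<lambda>us. dir_avg d (2 * l) (\<lambda>vs. dens V - 1 / real N ^ d * real (card (V \<inter> vis N (pos z us) vs)) - \<gamma>))"
    unfolding dir_avg_diff dir_avg_cmult dir_avg_const[OF d] H_def ..
  also have "\<dots> \<le> dir_avg d M (\<lambda>vs. dens (V - vis N z vs))"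
    unfolding eq by (intro dir_avg_mono lo)
  finally show "(1 - b) * dens V - \<gamma> \<le> dir_avg d M (\<lambda>vs. dens (V - vis N z vs))"
    by (simp add: algebra_simps diff_divide_distrib)
qed

text \<open>A block removes at most \<open>M\<close> points, so each value and the mean lie in the
  same interval of length \<open>\<delta>\<close>.\<close>

lemma block_deviation:
  assumes "V \<subseteq> torus d N" "length vs = M"
  shows "\<bar>dens (V - vis N z vs) - dir_avg d M (\<lambda>vs. dens (V - vis N z vs))\<bar> \<le> \<delta>"
proof -
  have fin: "finite V"
    using assms(1) finite_torus finite_subset by blast
  have up: "dens (V - vis N z ws) \<le> dens V" for ws
    using fin by (intro divide_right_mono) (auto intro: card_mono)
  have lo: "dens V - \<delta> \<le> dens (V - vis N z ws)" if "length ws = M" for ws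
  proof -
    have "card V \<le> card ((V - vis N z ws) \<union> vis N z ws)"
      using fin by (intro card_mono) auto
    also have "\<dots> \<le> card (V - vis N z ws) + card (vis N z ws)"
      by (rule card_Un_le)
    also have "card (vis N z ws) \<le> M"
      using card_vis_le[of N z ws] that by simp
    finally have "real (card V) - real M \<le> real (card (V - vis N z ws))"
      by linarith
    then show ?thesis
      by (simp add: \<delta>_def divide_right_mono diff_divide_distrib[symmetric])
  qed
  have "dir_avg d M (\<lambda>vs. dens (V - vis N z vs)) \<le> dens V"
    using dir_avg_mono[of M d "\<lambda>vs. dens (V - vis N z vs)" "\<lambda>_. dens V"] up by (simp add: dir_avg_const[OF d])
  moreover have "dens V - \<delta> \<le> dir_avg d M (\<lambda>vs. dens (V - vis N z vs))"
    using dir_avg_mono[of M d "\<lambda>_. dens V - \<delta>" "\<lambda>vs. dens (V - vis N z vs)"] lo by (simp add: dir_avg_const[OF d])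
  ultimately show ?thesis
    using up[of vs] lo[OF assms(2)] by linarith
qed

text \<open>The first block is split off and the induction hypothesis applied to the set left at its
  end, which is why \<open>z\<close> and \<open>V\<close> are arbitrary. Each block adds
  \<open>\<delta>^2\<close>, while the drift only lowers the positive part.\<close>

lemma excess_second_moment:
  assumes "a \<le> 1" "z \<in> torus d N" "V \<subseteq> torus d N"
  shows "dir_avg d (k * M) (\<lambda>vs. (max 0 (dens (V - vis N z vs) - s))\<^sup>2)
    \<le> (max 0 ((1 - a) ^ k * dens V - s))\<^sup>2 + real k * \<delta>\<^sup>2"
  using assms(2,3)
proof (induction k arbitrary: z V)
  case (Suc k)
  have a0: "a \<ge> 0"
    using G by (simp add: a_def)
  let ?F = "\<lambda>us. dens (V - vis N z us)"
  have "dir_avg d (Suc k * M) (\<lambda>vs. (max 0 (dens (V - vis N z vs) - s))\<^sup>2)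
      = dir_avg d M (\<lambda>us. dir_avg d (k * M) (\<lambda>vs. (max 0 (dens ((V - vis N z us) - vis N (pos z us) vs) - s))\<^sup>2))"
    by (simp add: dir_avg_append vis_append Diff_Un Diff_Diff_Int set_diff_eq)
  also have "\<dots> \<le> dir_avg d M (\<lambda>us. (max 0 ((1 - a) ^ k * ?F us - s))\<^sup>2 + real k * \<delta>\<^sup>2)"
    using Suc.prems N by (intro dir_avg_mono Suc.IH foldl_torus_step_in_torus) auto
  also have "\<dots> = dir_avg d M (\<lambda>us. (max 0 ((1 - a) ^ k * ?F us + (- s)))\<^sup>2) + real k * \<delta>\<^sup>2"
    by (simp add: dir_avg_add dir_avg_const[OF d])
  also have "dir_avg d M (\<lambda>us. (max 0 ((1 - a) ^ k * ?F us + (- s)))\<^sup>2)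
      \<le> (max 0 ((1 - a) ^ k * dir_avg d M ?F + (- s)))\<^sup>2 + \<delta>\<^sup>2"
    using Suc.prems a0 assms(1) by (intro dir_avg_pos_part_square block_deviation d) (auto simp: power_abs power_le_one)
  also have "(max 0 ((1 - a) ^ k * dir_avg d M ?F + (- s)))\<^sup>2 \<le> (max 0 ((1 - a) ^ Suc k * dens V - s))\<^sup>2"
  proof -
    have "(1 - a) ^ k * dir_avg d M ?F \<le> (1 - a) ^ k * ((1 - a) * dens V)"
      using Suc.prems a0 assms(1) by (intro mult_left_mono block_mean) auto
    then show ?thesis
      by (intro power_mono) (auto simp: mult_ac)
  qed
  finally show ?case
    by (simp add: algebra_simps)
qed simp

text \<open>The mirror image, with a negative factor \<open>c\<close>. In addition each block moves
  the threshold by at most \<open>\<gamma>\<close>, its mixing loss damped by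
  \<open>(1 - b)^k \<le> 1\<close>.\<close>

lemma deficit_second_moment:
  assumes "b \<le> 1" "z \<in> torus d N" "V \<subseteq> torus d N"
  shows "dir_avg d (k * M) (\<lambda>vs. (max 0 (s - dens (V - vis N z vs)))\<^sup>2)
    \<le> (max 0 (s + real k * \<gamma> - ((1 - b) ^ k) * dens V))\<^sup>2 + real k * \<delta>\<^sup>2"
  using assms(2,3)
proof (induction k arbitrary: z V)
  case (Suc k)
  have b0: "b \<ge> 0"
    by (simp add: b_def)
  have \<gamma>0: "\<gamma> \<ge> 0"
    by (simp add: \<gamma>_def)
  have pow: "0 \<le> (1 - b) ^ k" "(1 - b) ^ k \<le> 1"
    using b0 assms(1) by (auto intro: power_le_one)
  let ?F = "\<lambda>us. dens (V - vis N z us)"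
  let ?s = "s + real k * \<gamma>"
  have "dir_avg d (Suc k * M) (\<lambda>vs. (max 0 (s - dens (V - vis N z vs)))\<^sup>2)
      = dir_avg d M (\<lambda>us. dir_avg d (k * M) (\<lambda>vs. (max 0 (s - dens ((V - vis N z us) - vis N (pos z us) vs)))\<^sup>2))"
    by (simp add: dir_avg_append vis_append Diff_Un Diff_Diff_Int set_diff_eq)
  also have "\<dots> \<le> dir_avg d M (\<lambda>us. (max 0 (?s - ((1 - b) ^ k) * ?F us))\<^sup>2 + real k * \<delta>\<^sup>2)"
    using Suc.prems N by (intro dir_avg_mono Suc.IH foldl_torus_step_in_torus) auto
  also have "\<dots> = dir_avg d M (\<lambda>us. (max 0 (- ((1 - b) ^ k) * ?F us + ?s))\<^sup>2) + real k * \<delta>\<^sup>2"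
    by (simp add: dir_avg_add dir_avg_const[OF d] algebra_simps)
  also have "dir_avg d M (\<lambda>us. (max 0 (- ((1 - b) ^ k) * ?F us + ?s))\<^sup>2)
      \<le> (max 0 (- ((1 - b) ^ k) * dir_avg d M ?F + ?s))\<^sup>2 + \<delta>\<^sup>2"
    using Suc.prems pow by (intro dir_avg_pos_part_square block_deviation d) auto
  also have "(max 0 (- ((1 - b) ^ k) * dir_avg d M ?F + ?s))\<^sup>2
      \<le> (max 0 (s + real (Suc k) * \<gamma> - (1 - b) ^ Suc k * dens V))\<^sup>2"
  proof -
    have "(1 - b) ^ k * ((1 - b) * dens V - \<gamma>) \<le> (1 - b) ^ k * dir_avg d M ?F"
      using Suc.prems pow by (intro mult_left_mono block_mean) auto
    moreover have "(1 - b) ^ k * \<gamma> \<le> 1 * \<gamma>"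
      using pow \<gamma>0 by (intro mult_right_mono)
    moreover have "(1 - b) ^ k * ((1 - b) * dens V - \<gamma>) = (1 - b) ^ Suc k * dens V - (1 - b) ^ k * \<gamma>"
      by (simp only: right_diff_distrib power_Suc mult_ac)
    moreover have "real (Suc k) * \<gamma> = real k * \<gamma> + \<gamma>"
      by (simp add: algebra_simps)
    ultimately have "- ((1 - b) ^ k) * dir_avg d M ?F + ?s \<le> s + real (Suc k) * \<gamma> - (1 - b) ^ Suc k * dens V"
      unfolding mult_minus_left by linarith
    then show ?thesis
      by (intro power_mono max.mono) auto
  qed
  finally show ?case
    by (simp add: algebra_simps)
qed simp

lemma prob_dens_large:
  assumes "a \<le> 1" "z \<in> torus d N" "\<epsilon> > 0"
  shows "dir_avg d (k * M) (\<lambda>vs. of_bool (dens (torus d N - vis N z vs) > (1 - a) ^ k + \<epsilon>)) \<le> real k * \<delta>\<^sup>2 / \<epsilon>\<^sup>2"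
proof -
  have dens_torus: "dens (torus d N) = 1"
    using N by (simp add: card_torus)
  \<comment> \<open>Starting from the full torus, the threshold equals the predicted density, so the
    first term of the moment bound is zero.\<close>
  then have "dir_avg d (k * M) (\<lambda>vs. (max 0 (dens (torus d N - vis N z vs) - (1 - a) ^ k))\<^sup>2) \<le> real k * \<delta>\<^sup>2"
    using excess_second_moment[OF assms(1,2) order_refl, of k "(1 - a) ^ k"]
    unfolding dens_torus by simp
  then have "dir_avg d (k * M) (\<lambda>vs. (max 0 (dens (torus d N - vis N z vs) - (1 - a) ^ k))\<^sup>2) / \<epsilon>\<^sup>2
      \<le> real k * \<delta>\<^sup>2 / \<epsilon>\<^sup>2"
    by (rule divide_right_mono) simp
  from order_trans[OF Chebyshev_square[OF assms(3)] this] show ?thesis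
    by (simp add: algebra_simps)
qed

lemma prob_dens_small:
  assumes "b \<le> 1" "z \<in> torus d N" "\<epsilon> > 0"
  shows "dir_avg d (k * M) (\<lambda>vs. of_bool (dens (torus d N - vis N z vs) < (1 - b) ^ k - real k * \<gamma> - \<epsilon>))
    \<le> real k * \<delta>\<^sup>2 / \<epsilon>\<^sup>2"
proof -
  have dens_torus: "dens (torus d N) = 1"
    using N by (simp add: card_torus)
  then have "dir_avg d (k * M) (\<lambda>vs. (max 0 ((1 - b) ^ k - real k * \<gamma> - dens (torus d N - vis N z vs)))\<^sup>2) \<le> real k * \<delta>\<^sup>2"
    using deficit_second_moment[OF assms(1,2) order_refl, of k "(1 - b) ^ k - real k * \<gamma>"]
    unfolding dens_torus by simp
  then have "dir_avg d (k * M) (\<lambda>vs. (max 0 ((1 - b) ^ k - real k * \<gamma> - dens (torus d N - vis N z vs)))\<^sup>2) / \<epsilon>\<^sup>2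
      \<le> real k * \<delta>\<^sup>2 / \<epsilon>\<^sup>2"
    by (rule divide_right_mono) simp
  from order_trans[OF Chebyshev_square[OF assms(3)] this] show ?thesis
    by (simp add: algebra_simps)
qed

end

section \<open>Transfer to the law of the walk\<close>

abbreviation direction_seq :: "nat \<Rightarrow> (nat \<Rightarrow> nat \<times> int) measure" where
  "direction_seq d \<equiv> \<Pi>\<^sub>M n\<in>UNIV. measure_pmf (pmf_of_set (directions d))"

lemma measurable_direction: "(\<lambda>\<omega>. \<omega> n) \<in> direction_seq d \<rightarrow>\<^sub>M count_space UNIV"
proof -
  have "(\<lambda>\<omega>. \<omega> n) \<in> direction_seq d \<rightarrow>\<^sub>M measure_pmf (pmf_of_set (directions d))"
    by measurable
  then show ?thesis
    by simp
qed

lemma measurable_prefix: "(\<lambda>\<omega>. map \<omega> [0..<n]) \<in> direction_seq d \<rightarrow>\<^sub>M count_space UNIV"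
proof (induction n)
  case (Suc n)
  have "(\<lambda>\<omega>. vs @ [\<omega> n]) \<in> direction_seq d \<rightarrow>\<^sub>M count_space UNIV" for vs
    by (rule measurable_compose[OF measurable_direction]) simp
  from measurable_compose_countable[OF this Suc] show ?case
    by simp
qed simp

lemma sets_prefix: "{\<omega>. Q (map \<omega> [0..<n])} \<in> sets (direction_seq d)"
proof -
  have "(\<lambda>\<omega>. map \<omega> [0..<n]) -` {vs. Q vs} \<inter> space (direction_seq d) \<in> sets (direction_seq d)"
    by (rule measurable_sets[OF measurable_prefix]) simp
  then show ?thesis
    by (simp add: space_PiM vimage_def)
qed

text \<open>\<open>PiM_iter\<close> writes the product measure as the image under
  \<open>case_nat\<close> of a first direction and an independent sequence, matching the recursion
  of \<open>dir_avg\<close>.\<close>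

lemma emeasure_prefix:
  assumes "d > 0"
  shows "emeasure (direction_seq d) {\<omega>. Q (map \<omega> [0..<n])} = ennreal (dir_avg d n (\<lambda>vs. of_bool (Q vs)))"
proof (induction n arbitrary: Q)
  case 0
  interpret product_prob_space "\<lambda>_. measure_pmf (pmf_of_set (directions d))" "UNIV :: nat set"
    by unfold_locales
  have "emeasure (direction_seq d) UNIV = 1"
    using emeasure_space_1 by (simp add: space_PiM)
  then show ?case
    by simp
next
  case (Suc n)
  let ?p = "measure_pmf (pmf_of_set (directions d))"
  let ?S = "direction_seq d"
  interpret sequence_space ?p
    by unfold_locales
  let ?A = "{\<omega>. Q (map \<omega> [0..<Suc n])}"
  let ?f = "\<lambda>(s, \<omega>). case_nat s \<omega>"
  have f: "?f \<in> ?p \<Otimes>\<^sub>M ?S \<rightarrow>\<^sub>M ?S"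
    by measurable
  have A: "?A \<in> sets ?S"
    by (rule sets_prefix)
  have prefix: "map (case_nat v \<omega>) [0..<Suc n] = v # map \<omega> [0..<n]" for v \<omega>
    by (simp add: upt_conv_Cons map_Suc_upt[symmetric] del: upt_Suc)
  have ne: "directions d \<noteq> {}"
    using assms by (auto simp: directions_def)
  have "emeasure ?S ?A = emeasure (?p \<Otimes>\<^sub>M ?S) (?f -` ?A \<inter> space (?p \<Otimes>\<^sub>M ?S))"
    using f A by (subst PiM_iter[symmetric], subst emeasure_distr) auto
  also have "\<dots> = (\<integral>\<^sup>+v. emeasure ?S (Pair v -` (?f -` ?A \<inter> space (?p \<Otimes>\<^sub>M ?S))) \<partial>?p)"
    using f A by (intro emeasure_pair_measure_alt measurable_sets)
  also have "\<dots> = (\<integral>\<^sup>+v. ennreal (dir_avg d n (\<lambda>vs. of_bool (Q (v # vs)))) \<partial>?p)"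
  proof (intro nn_integral_cong)
    fix v
    have "Pair v -` (?f -` ?A \<inter> space (?p \<Otimes>\<^sub>M ?S)) = {\<omega>. Q (v # map \<omega> [0..<n])}"
      by (auto simp: space_pair_measure space_PiM prefix simp del: upt_Suc)
    then show "emeasure ?S (Pair v -` (?f -` ?A \<inter> space (?p \<Otimes>\<^sub>M ?S))) = ennreal (dir_avg d n (\<lambda>vs. of_bool (Q (v # vs))))"
      using Suc[of "\<lambda>vs. Q (v # vs)"] by (simp only:)
  qed
  also have "\<dots> = (\<Sum>v\<in>directions d. ennreal (dir_avg d n (\<lambda>vs. of_bool (Q (v # vs))))) / ennreal (2 * real d)"
    using ne by (subst nn_integral_pmf_of_set) (simp_all add: ennreal_of_nat_eq_real_of_nat)
  also have "\<dots> = ennreal (dir_avg d (Suc n) (\<lambda>vs. of_bool (Q vs)))"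
  proof -
    have "dir_avg d n (\<lambda>vs. of_bool (Q (v # vs))) \<ge> 0" for v
      using dir_avg_mono[of n d "\<lambda>_. 0" "\<lambda>vs. of_bool (Q (v # vs))"] by (simp add: dir_avg_const assms)
    then show ?thesis
      using assms by (simp add: sum_ennreal divide_ennreal sum_nonneg)
  qed
  finally show ?case .
qed

lemma prob_space_direction_seq: "prob_space (direction_seq d)"
proof -
  interpret product_prob_space "\<lambda>_. measure_pmf (pmf_of_set (directions d))" "UNIV :: nat set"
    by unfold_locales
  show ?thesis
    by unfold_locales
qed

lemma measure_prefix:
  assumes "d > 0"
  shows "measure (direction_seq d) {\<omega>. Q (map \<omega> [0..<n])} = dir_avg d n (\<lambda>vs. of_bool (Q vs))"
proof -
  have "dir_avg d n (\<lambda>vs. of_bool (Q vs)) \<ge> 0"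
    using dir_avg_mono[of n d "\<lambda>_. 0" "\<lambda>vs. of_bool (Q vs)"] by (simp add: dir_avg_const assms)
  then show ?thesis
    by (simp add: measure_def emeasure_prefix assms)
qed

lemma walk_eq_foldl: "walk N (z, \<omega>) n = foldl (torus_step N) z (map \<omega> [0..<n])"
  by (induction n) auto

lemma vis_eq_walk: "vis N z (map \<omega> [0..<n]) = walk N (z, \<omega>) ` {..<n}"
  by (induction n) (auto simp: vis_append walk_eq_foldl lessThan_Suc)

text \<open>Fubini: a bound on the complement that is uniform over the starting point survives
  integration over it.\<close>

lemma measure_driving_ge:
  assumes "d > 0" "N > 0" "A \<in> sets (driving d N)" "e \<ge> 0"
    and "\<And>z. z \<in> torus d N \<Longrightarrow> measure (direction_seq d) {\<omega>. (z, \<omega>) \<notin> A} \<le> e"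
  shows "1 - e \<le> measure (driving d N) A"
proof -
  let ?p = "measure_pmf (pmf_of_set (torus d N))"
  let ?S = "direction_seq d"
  interpret S: prob_space ?S
    by (rule prob_space_direction_seq)
  interpret pair_prob_space ?p ?S
    by unfold_locales
  have driving: "driving d N = ?p \<Otimes>\<^sub>M ?S"
    by (simp add: driving_def)
  have space: "space (?p \<Otimes>\<^sub>M ?S) = UNIV"
    by (simp add: space_pair_measure space_PiM)
  have A: "- A \<in> sets (?p \<Otimes>\<^sub>M ?S)"
    using sets.compl_sets[OF assms(3)] unfolding driving space by (simp add: Compl_eq_Diff_UNIV)
  have "torus d N \<noteq> {}"
    using torus_zero_in_torus assms(2) by blast
  then have "AE z in ?p. emeasure ?S (Pair z -` (- A)) \<le> ennreal e"
    using assms(5) by (auto simp: AE_measure_pmf_iff S.emeasure_eq_measure vimage_def intro!: ennreal_leI)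
  then have "(\<integral>\<^sup>+z. emeasure ?S (Pair z -` (- A)) \<partial>?p) \<le> (\<integral>\<^sup>+z. ennreal e \<partial>?p)"
    by (rule nn_integral_mono_AE)
  then have "emeasure (?p \<Otimes>\<^sub>M ?S) (- A) \<le> ennreal e"
    using A by (simp add: S.emeasure_pair_measure_alt)
  then have "prob (- A) \<le> e"
    using assms(4) by (simp add: emeasure_eq_measure)
  moreover have "prob (- A) = 1 - prob A"
    using prob_compl[of A] assms(3) unfolding driving space by (simp add: Compl_eq_Diff_UNIV)
  ultimately show ?thesis
    unfolding driving by linarith
qed

text \<open>The count is a finite sum of indicators, and visiting a given point is a countable union
  of coordinate events.\<close>

lemma measurable_vacant_density:
  "(\<lambda>X. real (card (torus d N - visited X t)) / c) \<in> borel_measurable (\<Pi>\<^sub>M n\<in>(UNIV :: nat set). count_space UNIV)"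
proof -
  let ?P = "\<Pi>\<^sub>M n\<in>(UNIV :: nat set). count_space (UNIV :: (nat \<Rightarrow> int) set)"
  have "{X. X n = x} \<in> sets ?P" for n x
  proof -
    have "(\<lambda>X. X n) -` {x} \<inter> space ?P \<in> sets ?P"
      by (rule measurable_sets[of _ _ "count_space UNIV"]) (auto intro: measurable_component_singleton)
    then show ?thesis
      by (simp add: space_PiM vimage_def)
  qed
  then have "(\<Union>n\<in>{n. real n \<le> t}. {X. X n = x}) \<in> sets ?P" for x
    by (intro sets.countable_UN'') auto
  moreover have "(\<Union>n\<in>{n. real n \<le> t}. {X. X n = x}) = {X. x \<in> visited X t}" for x :: "nat \<Rightarrow> int"
    by (auto simp: visited_def)
  ultimately have "{X. x \<in> visited X t} \<in> sets ?P" for x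
    by metis
  then have "(\<lambda>X. (\<Sum>x\<in>torus d N. 1 - indicator {X. x \<in> visited X t} X) / c) \<in> borel_measurable ?P"
    by measurable
  moreover have "(\<Sum>x\<in>torus d N. 1 - indicator {X. x \<in> visited X t} X) = real (card (torus d N - visited X t))" for X
  proof -
    have "(\<Sum>x\<in>torus d N. 1 - indicator {X. x \<in> visited X t} X) = (\<Sum>x\<in>torus d N. if x \<in> visited X t then 0 else 1 :: real)"
      by (intro sum.cong) (auto simp: indicator_def)
    then show ?thesis
      by (simp add: sum.If_cases Diff_eq)
  qed
  ultimately show ?thesis
    by simp
qed

context block_walk
begin

text \<open>\<open>t\<close> lies between the ends of blocks \<open>k\<close> and
  \<open>Suc k\<close>, and the vacant set only shrinks, so the density at \<open>t\<close> is
  squeezed between those after \<open>Suc k\<close> and \<open>k\<close> blocks. The factor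
  \<open>2 * k + 1\<close> adds the two failure probabilities.\<close>

lemma prob_vacant_density:
  assumes "a \<le> 1" "b \<le> 1" "\<epsilon> > 0"
    and t: "real (k * M) \<le> t" "t < real (Suc k * M)"
    and hi: "(1 - a) ^ k + \<epsilon> \<le> hi"
    and lo: "lo \<le> (1 - b) ^ Suc k - real (Suc k) * \<gamma> - \<epsilon>"
  shows "1 - (2 * real k + 1) * \<delta>\<^sup>2 / \<epsilon>\<^sup>2 \<le> measure (srw_law d N) {X \<in> space (srw_law d N).
    lo \<le> dens (torus d N - visited X t) \<and> dens (torus d N - visited X t) \<le> hi}"
proof -
  let ?P = "\<Pi>\<^sub>M n\<in>(UNIV :: nat set). count_space (UNIV :: (nat \<Rightarrow> int) set)"
  let ?f = "\<lambda>X. dens (torus d N - visited X t)"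
  let ?E = "{X \<in> space (srw_law d N). lo \<le> ?f X \<and> ?f X \<le> hi}"
  let ?e = "(2 * real k + 1) * \<delta>\<^sup>2 / \<epsilon>\<^sup>2"
  have "?f \<in> borel_measurable ?P"
    by (rule measurable_vacant_density)
  then have "{X \<in> space ?P. lo \<le> ?f X \<and> ?f X \<le> hi} \<in> sets ?P"
    by measurable
  then have E: "?E \<in> sets ?P"
    by (simp add: space_PiM)
  have "1 - ?e \<le> measure (driving d N) (walk N -` ?E \<inter> space (driving d N))"
  proof (rule measure_driving_ge[OF d N])
    show "walk N -` ?E \<inter> space (driving d N) \<in> sets (driving d N)"
      using measurable_walk E by (rule measurable_sets)
    fix z assume z: "z \<in> torus d N"
    interpret S: prob_space "direction_seq d"
      by (rule prob_space_direction_seq)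
    let ?L = "\<lambda>vs. dens (torus d N - vis N z vs) > (1 - a) ^ k + \<epsilon>"
    let ?U = "\<lambda>vs. dens (torus d N - vis N z vs) < (1 - b) ^ Suc k - real (Suc k) * \<gamma> - \<epsilon>"
    have "{\<omega>. (z, \<omega>) \<notin> walk N -` ?E \<inter> space (driving d N)}
        \<subseteq> {\<omega>. ?L (map \<omega> [0..<k * M])} \<union> {\<omega>. ?U (map \<omega> [0..<Suc k * M])}"
    proof (rule subsetI, rule ccontr)
      fix \<omega>
      assume bad: "\<omega> \<in> {\<omega>. (z, \<omega>) \<notin> walk N -` ?E \<inter> space (driving d N)}"
        and good: "\<omega> \<notin> {\<omega>. ?L (map \<omega> [0..<k * M])} \<union> {\<omega>. ?U (map \<omega> [0..<Suc k * M])}"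
      let ?X = "walk N (z, \<omega>)"
      have "vis N z (map \<omega> [0..<k * M]) \<subseteq> visited ?X t"
        unfolding vis_eq_walk visited_def using t(1)
        by (auto intro!: exI order_trans[OF _ t(1)] simp: less_imp_le simp del: of_nat_mult)
      then have "?f ?X \<le> dens (torus d N - vis N z (map \<omega> [0..<k * M]))"
        by (intro divide_right_mono of_nat_mono card_mono) auto
      moreover have "visited ?X t \<subseteq> vis N z (map \<omega> [0..<Suc k * M])"
      proof
        fix x assume "x \<in> visited ?X t"
        then obtain n where n: "x = ?X n" "real n \<le> t"
          by (auto simp: visited_def)
        then have "real n < real (Suc k * M)"
          using t(2) by linarith
        then show "x \<in> vis N z (map \<omega> [0..<Suc k * M])"
          unfolding vis_eq_walk n(1) by (intro imageI) (simp only: of_nat_less_iff lessThan_iff)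
      qed
      then have "dens (torus d N - vis N z (map \<omega> [0..<Suc k * M])) \<le> ?f ?X"
        by (intro divide_right_mono of_nat_mono card_mono) auto
      ultimately have "lo \<le> ?f ?X \<and> ?f ?X \<le> hi"
        using good hi lo by (simp only: Un_iff mem_Collect_eq) linarith
      with bad show False
        by (simp add: driving_def space_pair_measure space_PiM)
    qed
    then have "S.prob {\<omega>. (z, \<omega>) \<notin> walk N -` ?E \<inter> space (driving d N)}
        \<le> S.prob ({\<omega>. ?L (map \<omega> [0..<k * M])} \<union> {\<omega>. ?U (map \<omega> [0..<Suc k * M])})"
      by (intro S.finite_measure_mono sets.Un sets_prefix)
    also have "\<dots> \<le> S.prob {\<omega>. ?L (map \<omega> [0..<k * M])} + S.prob {\<omega>. ?U (map \<omega> [0..<Suc k * M])}"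
      by (intro measure_Un_le sets_prefix)
    also have "\<dots> \<le> real k * \<delta>\<^sup>2 / \<epsilon>\<^sup>2 + real (Suc k) * \<delta>\<^sup>2 / \<epsilon>\<^sup>2"
      unfolding measure_prefix[OF d, where Q = ?L] measure_prefix[OF d, where Q = ?U]
      by (intro add_mono prob_dens_large prob_dens_small assms z)
    also have "\<dots> = ?e"
      by (simp add: add_divide_distrib[symmetric] algebra_simps)
    finally show "S.prob {\<omega>. (z, \<omega>) \<notin> walk N -` ?E \<inter> space (driving d N)} \<le> ?e" .
  qed simp
  also have "\<dots> = measure (srw_law d N) ?E"
    unfolding srw_law_def using measurable_walk E by (subst measure_distr) (auto simp: srw_law_def)
  finally show ?thesis .
qed

end

section \<open>Exponential bounds, block sizes and the limit\<close>

lemma one_minus_power_le_exp: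
  fixes y :: real
  assumes "y \<le> 1"
  shows "(1 - y) ^ n \<le> exp (- (real n * y))"
proof -
  have "(1 - y) ^ n \<le> exp (- y) ^ n"
    using assms exp_ge_add_one_self[of "- y"] by (intro power_mono) auto
  then show ?thesis
    by (simp add: exp_of_nat_mult[symmetric])
qed

lemma exp_le_one_minus_power:
  fixes y :: real
  assumes "y < 1"
  shows "exp (- (real n * (y / (1 - y)))) \<le> (1 - y) ^ n"
proof -
  have "inverse (1 - y) = 1 + y / (1 - y)"
    using assms by (simp add: field_simps)
  also have "\<dots> \<le> exp (y / (1 - y))"
    by (rule exp_ge_add_one_self)
  finally have "exp (- (y / (1 - y))) \<le> 1 - y"
    using assms by (simp add: exp_minus field_simps)
  then have "exp (- (y / (1 - y))) ^ n \<le> (1 - y) ^ n"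
    by (intro power_mono) auto
  then show ?thesis
    by (simp add: exp_of_nat_mult[symmetric])
qed

text \<open>Lower exponent: \<open>b / (1 - b) \<le> 5/3 * \<delta>\<close> and
  \<open>(k + 1) * \<delta> \<le> 11/10 * u\<close> multiply to \<open>11/6 * u\<close>. Upper
  exponent: \<open>a \<ge> \<delta> / (3 * G)\<close> and \<open>k * \<delta> \<ge> 3/4 * u\<close>
  give \<open>u / (4 * G)\<close>. Relaxing these to \<open>2 * u\<close> and
  \<open>u / (8 * G)\<close> leaves room for \<open>\<epsilon>\<close>.\<close>

lemma (in block_walk) prob_vacant_density_exp:
  assumes "l > 0" "\<tau> \<le> l" "G \<ge> 1" "u > 0" "\<epsilon> > 0"
    and \<delta>_le: "\<delta> \<le> 1 / 20" "\<delta> \<le> u / 10"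
    and gaps: "(u + \<delta>) * (real \<tau> / (2 * real l)) \<le> \<epsilon>"
    and \<epsilon>1: "\<epsilon> \<le> exp (- (u / (8 * G))) - exp (- (u / (4 * G)))"
    and \<epsilon>2: "2 * \<epsilon> \<le> exp (- (11 / 6 * u)) - exp (- (2 * u))"
  shows "1 - (2 * u + \<delta>) * \<delta> / \<epsilon>\<^sup>2 \<le> measure (srw_law d N) {X \<in> space (srw_law d N).
    exp (- (2 * u)) \<le> dens (torus d N - visited X (u * real N ^ d)) \<and>
    dens (torus d N - visited X (u * real N ^ d)) \<le> exp (- (u / (8 * G)))}"
proof -
  define x where "x = real N ^ d"
  have x: "x > 0"
    using N by (simp add: x_def)
  have M: "real M > 0" "2 * real l \<le> real M" "real M \<le> 3 * real l"
    using assms(1,2) by (auto simp: M_def)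
  define k where "k = nat \<lfloor>u * x / real M\<rfloor>"
  have "0 \<le> u * x / real M"
    using assms(4) x M by simp
  then have "real k \<le> u * x / real M" "u * x / real M < real k + 1"
    unfolding k_def by linarith+
  then have k: "real (k * M) \<le> u * x" "u * x < real (Suc k * M)"
    using M by (simp_all add: pos_le_divide_eq pos_divide_less_eq distrib_right add.commute)
  have \<delta>: "\<delta> = real M / x"
    by (simp add: \<delta>_def x_def)
  have \<delta>0: "\<delta> > 0"
    using M x by (simp add: \<delta>)
  have k\<delta>: "real k * \<delta> \<le> u" "u \<le> real k * \<delta> + \<delta>"
    using k x by (simp_all add: \<delta> field_simps)
  have a_le: "a \<le> \<delta>"
  proof -
    have "a \<le> real l / (1 * x)"
      unfolding a_def x_def[symmetric] using assms(3) x by (intro divide_left_mono mult_right_mono mult_pos_pos) auto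
    also have "\<dots> \<le> \<delta>"
      unfolding \<delta> using M x by (simp add: divide_right_mono)
    finally show ?thesis .
  qed
  have a_ge: "\<delta> / (3 * G) \<le> a"
  proof -
    have "\<delta> / (3 * G) = real M / (3 * G * x)"
      by (simp add: \<delta> mult.commute)
    also have "\<dots> \<le> (3 * real l) / (3 * G * x)"
      using M G x by (intro divide_right_mono) auto
    finally show ?thesis
      by (simp add: a_def x_def mult.assoc)
  qed
  have b_le: "b \<le> 3 / 2 * \<delta>"
  proof -
    have "3 * real l / x \<le> 3 / 2 * real M / x"
      using M x by (intro divide_right_mono) auto
    then show ?thesis
      unfolding b_def \<delta> x_def by (simp only: times_divide_eq_right)
  qed
  have b0: "b \<ge> 0"
    by (simp add: b_def)
  have b1: "b \<le> 1 / 10"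
    using b_le \<delta>_le by linarith
  have hi: "(1 - a) ^ k + \<epsilon> \<le> exp (- (u / (8 * G)))"
  proof -
    have "u / (4 * G) = 3 / 4 * u / (3 * G)"
      by simp
    also have "\<dots> \<le> (real k * \<delta>) / (3 * G)"
      using k\<delta> \<delta>_le assms(4) G by (intro divide_right_mono) auto
    also have "\<dots> \<le> real k * a"
      using mult_left_mono[OF a_ge, of "real k"] by simp
    finally have "exp (- (real k * a)) \<le> exp (- (u / (4 * G)))"
      by simp
    moreover have "(1 - a) ^ k \<le> exp (- (real k * a))"
      using a_le \<delta>_le by (intro one_minus_power_le_exp) auto
    ultimately show ?thesis
      using \<epsilon>1 by linarith
  qed
  have lo: "exp (- (2 * u)) \<le> (1 - b) ^ Suc k - real (Suc k) * \<gamma> - \<epsilon>"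
  proof -
    have Suc_k\<delta>: "real (Suc k) * \<delta> \<le> u + \<delta>"
      using k\<delta> by (simp add: algebra_simps)
    have "b / (1 - b) \<le> b / (9 / 10)"
      using b0 b1 by (intro divide_left_mono) auto
    also have "\<dots> \<le> 5 / 3 * \<delta>"
      using b_le by simp
    finally have "real (Suc k) * (b / (1 - b)) \<le> real (Suc k) * (5 / 3 * \<delta>)"
      by (intro mult_left_mono) auto
    also have "\<dots> \<le> 11 / 6 * u"
      using Suc_k\<delta> \<delta>_le(2) by linarith
    finally have "exp (- (11 / 6 * u)) \<le> exp (- (real (Suc k) * (b / (1 - b))))"
      by simp
    also have "\<dots> \<le> (1 - b) ^ Suc k"
      using b1 by (intro exp_le_one_minus_power) auto
    finally have "exp (- (11 / 6 * u)) \<le> (1 - b) ^ Suc k" .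
    \<comment> \<open>The mixing loss takes one of the two \<open>\<epsilon>\<close> reserved on the
      lower side; the fluctuation takes the other.\<close>
    moreover have "real (Suc k) * \<gamma> \<le> \<epsilon>"
    proof -
      have "\<gamma> = 2 * real l / x * (real \<tau> / (2 * real l))"
        using assms(1) by (simp add: \<gamma>_def x_def)
      also have "\<dots> \<le> \<delta> * (real \<tau> / (2 * real l))"
        unfolding \<delta> using M x by (intro mult_right_mono divide_right_mono) auto
      finally have "real (Suc k) * \<gamma> \<le> real (Suc k) * (\<delta> * (real \<tau> / (2 * real l)))"
        by (intro mult_left_mono) auto
      also have "\<dots> = (real (Suc k) * \<delta>) * (real \<tau> / (2 * real l))"
        by (simp only: mult.assoc)
      also have "\<dots> \<le> (u + \<delta>) * (real \<tau> / (2 * real l))"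
        by (intro mult_right_mono Suc_k\<delta>) auto
      finally show ?thesis
        using gaps by linarith
    qed
    ultimately show ?thesis
      using \<epsilon>2 by linarith
  qed
  have "(2 * real k + 1) * \<delta>\<^sup>2 = (2 * (real k * \<delta>) + \<delta>) * \<delta>"
    by (simp add: power2_eq_square algebra_simps)
  also have "\<dots> \<le> (2 * u + \<delta>) * \<delta>"
    using k\<delta>(1) \<delta>0 by (intro mult_right_mono) auto
  finally have "1 - (2 * u + \<delta>) * \<delta> / \<epsilon>\<^sup>2 \<le> 1 - (2 * real k + 1) * \<delta>\<^sup>2 / \<epsilon>\<^sup>2"
    by (intro diff_left_mono divide_right_mono) auto
  also have "\<dots> \<le> measure (srw_law d N) {X \<in> space (srw_law d N).
      exp (- (2 * u)) \<le> dens (torus d N - visited X (u * real N ^ d)) \<and>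
      dens (torus d N - visited X (u * real N ^ d)) \<le> exp (- (u / (8 * G)))}"
    using a_le b1 \<delta>_le k hi lo assms(5) unfolding x_def by (intro prob_vacant_density) auto
  finally show ?thesis .
qed

text \<open>After \<open>N^2 * r\<close> steps the error in \<open>heat_mixing\<close> is at most
  \<open>2 * N^(-2d)\<close>, hence at most \<open>N^(-d)\<close>, which turns
  \<open>2 / N^d\<close> into the bounds \<open>1 / N^d\<close> and \<open>3 / N^d\<close>. A window
  no longer than \<open>N^d\<close> adds at most \<open>1\<close> to the Green function.\<close>

lemma block_walk_logarithmic_gap:
  assumes "d \<ge> 3" "N \<ge> 2" "real d ^ 2 * ln (real N) \<le> real r" "2 * (N\<^sup>2 * r\<^sup>2) \<le> N ^ d"
  shows "block_walk d N (N\<^sup>2 * r) (N\<^sup>2 * r\<^sup>2) (1 + green_const d)"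
proof
  have N: "real N > 0"
    using assms by simp
  have "2 \<le> N ^ d"
    using assms self_le_power[of N d] by linarith
  then have "real 2 \<le> real (N ^ d)"
    by (simp only: of_nat_le_iff)
  then have x: "real N ^ d \<ge> 2"
    by simp
  show "d > 0" "N > 0"
    using assms by auto
  show "1 + green_const d > 0"
    by (simp add: green_const_def add_pos_nonneg)
  fix x assume xt: "x \<in> torus d N"
  have "(\<Sum>i<2 * (N\<^sup>2 * r\<^sup>2). heat d N i x x) \<le> real (2 * (N\<^sup>2 * r\<^sup>2)) / real N ^ d + green_const d"
    using assms xt by (intro green_bound) auto
  also have "real (2 * (N\<^sup>2 * r\<^sup>2)) / real N ^ d \<le> 1"
    using assms(4) N by (simp only: of_nat_power[symmetric] of_nat_le_iff divide_le_eq_1) auto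
  finally show "(\<Sum>i<2 * (N\<^sup>2 * r\<^sup>2). heat d N i x x) \<le> 1 + green_const d"
    by simp
  fix z n assume z: "z \<in> torus d N" and n: "n \<ge> N\<^sup>2 * r"
  have "real d * ln (real N) \<le> real r / real d"
    using assms by (simp add: field_simps power2_eq_square)
  also have "\<dots> = real (N\<^sup>2 * r) / (real d * (real N)\<^sup>2)"
    using N by simp
  also have "\<dots> \<le> real n / (real d * (real N)\<^sup>2)"
    using n by (intro divide_right_mono of_nat_mono) auto
  finally have "exp (- (2 * real n / (real d * (real N)\<^sup>2))) \<le> exp (- (2 * (real d * ln (real N))))"
    by simp
  also have "\<dots> = 1 / (real N ^ d)\<^sup>2"
    using N by (simp add: exp_minus exp_double exp_of_nat_mult inverse_eq_divide)
  finally have "2 * exp (- (2 * real n / (real d * (real N)\<^sup>2))) \<le> 2 / (real N ^ d)\<^sup>2"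
    by simp
  also have "\<dots> \<le> real N ^ d / (real N ^ d)\<^sup>2"
    using x by (intro divide_right_mono) auto
  also have "\<dots> = 1 / real N ^ d"
    by (simp add: power2_eq_square)
  finally have "\<bar>heat d N n z x + heat d N (Suc n) z x - 2 / real N ^ d\<bar> \<le> 1 / real N ^ d"
    using heat_mixing[of d N z x n] assms z xt by simp
  moreover have "3 / real N ^ d = 2 / real N ^ d + 1 / real N ^ d" "1 / real N ^ d = 2 / real N ^ d - 1 / real N ^ d"
    by (simp_all add: add_divide_distrib[symmetric] diff_divide_distrib[symmetric])
  ultimately show "1 / real N ^ d \<le> heat d N n z x + heat d N (Suc n) z x
      \<and> heat d N n z x + heat d N (Suc n) z x \<le> 3 / real N ^ d"
    unfolding abs_le_iff by linarith
qed

theorem corollary4p5: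
  fixes d :: nat
  assumes "d \<ge> 3"
  shows "\<exists>c c' :: real. c > 0 \<and> c' > 0 \<and>
    (\<forall>u :: real. u > 0 \<longrightarrow>
      (\<lambda>N :: nat. measure (srw_law d N)
        {X \<in> space (srw_law d N).
          exp (- c * u) \<le> real (card (torus d N - visited X (u * real N ^ d))) / real N ^ d \<and>
          real (card (torus d N - visited X (u * real N ^ d))) / real N ^ d \<le> exp (- c' * u)})
      \<longlonglongrightarrow> 1)"
proof -
  define G where "G = 1 + green_const d"
  have G_ge: "G \<ge> 1"
    by (simp add: G_def green_const_def)
  define r :: "nat \<Rightarrow> nat" where "r N = d\<^sup>2 * nat \<lceil>ln (real N)\<rceil>" for N
  \<comment> \<open>The \<open>\<delta>\<close> of \<open>block_walk\<close> for the chosen sizes,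
    as a function of \<open>N\<close>.\<close>
  define D where "D N = real (N\<^sup>2 * r N + 2 * (N\<^sup>2 * (r N)\<^sup>2)) / real N ^ d" for N
  have r_ge: "real d ^ 2 * ln (real N) \<le> real (r N)" for N
    unfolding r_def of_nat_mult of_nat_power by (intro mult_left_mono) (auto intro: real_nat_ceiling_ge)
  have r_at_top: "filterlim (\<lambda>N. real (r N)) at_top sequentially"
  proof (rule filterlim_at_top_mono)
    show "filterlim (\<lambda>N. real d ^ 2 * ln (real N)) at_top sequentially"
      using assms by (intro filterlim_tendsto_pos_mult_at_top[OF tendsto_const]
        filterlim_compose[OF ln_at_top filterlim_real_sequentially]) auto
  qed (use r_ge in auto)
  have D0: "D \<longlonglongrightarrow> 0"
  proof (rule tendsto_sandwich)
    show "\<forall>\<^sub>F N in sequentially. 0 \<le> D N"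
      by (simp add: D_def)
    have "(\<lambda>N. 3 * real d ^ 4 * ((ln (real N) + 1)\<^sup>2 / real N)) \<longlonglongrightarrow> 3 * real d ^ 4 * 0"
      by (intro tendsto_mult tendsto_const) real_asymp
    then show "(\<lambda>N. 3 * real d ^ 4 * ((ln (real N) + 1)\<^sup>2 / real N)) \<longlonglongrightarrow> 0"
      by simp
    show "\<forall>\<^sub>F N in sequentially. D N \<le> 3 * real d ^ 4 * ((ln (real N) + 1)\<^sup>2 / real N)"
      using eventually_ge_at_top[of 1]
    proof eventually_elim
      case (elim N)
      then have N: "real N \<ge> 1"
        by simp
      have "r N \<le> (r N)\<^sup>2"
        by (simp add: power2_nat_le_imp_le)
      then have "N\<^sup>2 * r N + 2 * (N\<^sup>2 * (r N)\<^sup>2) \<le> 3 * (N\<^sup>2 * (r N)\<^sup>2)"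
        by simp
      then have "real (N\<^sup>2 * r N + 2 * (N\<^sup>2 * (r N)\<^sup>2)) \<le> real (3 * (N\<^sup>2 * (r N)\<^sup>2))"
        by (rule of_nat_mono)
      also have "\<dots> = 3 * ((real N)\<^sup>2 * (real (r N))\<^sup>2)"
        by simp
      \<comment> \<open>Here \<open>d \<ge> 3\<close> leaves a full power of \<open>N\<close> to
        absorb the squared logarithm.\<close>
      finally have "D N \<le> 3 * ((real N)\<^sup>2 * (real (r N))\<^sup>2) / real N ^ 3"
        unfolding D_def using N assms by (intro frac_le power_increasing) auto
      also have "\<dots> = 3 * (real (r N))\<^sup>2 / real N"
        using N by (simp add: power2_eq_square power3_eq_cube)
      also have "\<dots> \<le> 3 * (real d ^ 2 * (ln (real N) + 1))\<^sup>2 / real N"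
      proof -
        have "real (nat \<lceil>ln (real N)\<rceil>) \<le> ln (real N) + 1"
          using N ln_ge_zero[of "real N"] by linarith
        then have "real (r N) \<le> real d ^ 2 * (ln (real N) + 1)"
          unfolding r_def of_nat_mult of_nat_power by (intro mult_left_mono) auto
        then show ?thesis
          by (intro divide_right_mono mult_left_mono power_mono) auto
      qed
      finally show ?case
        by (simp add: power_mult_distrib)
    qed
  qed simp
  have "(\<lambda>N. measure (srw_law d N)
        {X \<in> space (srw_law d N).
          exp (- 2 * u) \<le> real (card (torus d N - visited X (u * real N ^ d))) / real N ^ d \<and>
          real (card (torus d N - visited X (u * real N ^ d))) / real N ^ d \<le> exp (- (1 / (8 * G)) * u)})
      \<longlonglongrightarrow> 1" (is "?m \<longlonglongrightarrow> 1") if u: "u > 0" for u :: real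
  proof (rule tendsto_sandwich)
    \<comment> \<open>The room left by relaxing the exponents; it depends on \<open>u\<close> and
      \<open>G\<close> but not on \<open>N\<close>, so the failure probability vanishes as
      \<open>D N\<close> does.\<close>
    define \<epsilon> where "\<epsilon> = min (exp (- (u / (8 * G))) - exp (- (u / (4 * G)))) ((exp (- (11 / 6 * u)) - exp (- (2 * u))) / 2)"
    have \<epsilon>_le: "\<epsilon> \<le> exp (- (u / (8 * G))) - exp (- (u / (4 * G)))"
        "\<epsilon> \<le> (exp (- (11 / 6 * u)) - exp (- (2 * u))) / 2"
      unfolding \<epsilon>_def by (rule min.cobounded1, rule min.cobounded2)
    have \<epsilon>: "\<epsilon> > 0"
      using u G_ge by (auto simp: \<epsilon>_def field_simps)
    have "(\<lambda>N. 1 - (2 * u + D N) * D N / \<epsilon>\<^sup>2) \<longlonglongrightarrow> 1 - (2 * u + 0) * 0 / \<epsilon>\<^sup>2"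
      using \<epsilon> by (intro tendsto_intros D0) auto
    then show "(\<lambda>N. 1 - (2 * u + D N) * D N / \<epsilon>\<^sup>2) \<longlonglongrightarrow> 1"
      by simp
    show "\<forall>\<^sub>F N in sequentially. ?m N \<le> 1"
      by (intro always_eventually allI prob_space.prob_le_1 prob_space_srw_law)
    have "(\<lambda>N. (u + D N) * (1 / (2 * real (r N)))) \<longlonglongrightarrow> (u + 0) * 0"
      by (intro tendsto_intros D0 tendsto_divide_0[OF tendsto_const]
        filterlim_at_top_imp_at_infinity filterlim_tendsto_pos_mult_at_top[OF tendsto_const _ r_at_top]) auto
    then have "\<forall>\<^sub>F N in sequentially. (u + D N) * (1 / (2 * real (r N))) < \<epsilon>"
      using \<epsilon> by (intro order_tendstoD(2)) auto
    moreover have "\<forall>\<^sub>F N in sequentially. D N < min (1 / 20) (u / 10)"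
      using u by (intro order_tendstoD(2)[OF D0]) auto
    moreover have "\<forall>\<^sub>F N in sequentially. real (r N) \<ge> 1"
      using r_at_top unfolding filterlim_at_top by blast
    ultimately show "\<forall>\<^sub>F N in sequentially. 1 - (2 * u + D N) * D N / \<epsilon>\<^sup>2 \<le> ?m N"
      using eventually_ge_at_top[of 2]
    proof eventually_elim
      case (elim N)
      have x: "real N ^ d > 0"
        using elim by simp
      have "D N \<le> 1"
        using elim(2) by simp
      then have "real (N\<^sup>2 * r N + 2 * (N\<^sup>2 * (r N)\<^sup>2)) \<le> 1 * real N ^ d"
        unfolding D_def pos_divide_le_eq[OF x] .
      then have "real (N\<^sup>2 * r N + 2 * (N\<^sup>2 * (r N)\<^sup>2)) \<le> real (N ^ d)"
        by simp
      then have le: "2 * (N\<^sup>2 * (r N)\<^sup>2) \<le> N ^ d"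
        unfolding of_nat_le_iff by linarith
      interpret block_walk d N "N\<^sup>2 * r N" "N\<^sup>2 * (r N)\<^sup>2" G
        unfolding G_def using assms elim(4) r_ge le by (rule block_walk_logarithmic_gap)
      have \<delta>_eq: "\<delta> = D N"
        by (simp add: \<delta>_def M_def D_def)
      have ratio: "real (N\<^sup>2 * r N) / (2 * real (N\<^sup>2 * (r N)\<^sup>2)) = 1 / (2 * real (r N))"
        using elim by (simp add: power2_eq_square)
      have \<delta>_le: "\<delta> \<le> 1 / 20" "\<delta> \<le> u / 10"
        using elim(2) unfolding \<delta>_eq by auto
      have pos_l: "N\<^sup>2 * (r N)\<^sup>2 > 0"
        using elim by simp
      have "r N \<le> (r N)\<^sup>2"
        by (simp add: power2_nat_le_imp_le)
      then have gap_le: "N\<^sup>2 * r N \<le> N\<^sup>2 * (r N)\<^sup>2"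
        by (rule mult_le_mono2)
      have \<epsilon>2: "2 * \<epsilon> \<le> exp (- (11 / 6 * u)) - exp (- (2 * u))"
        using mult_left_mono[OF \<epsilon>_le(2), of 2] by simp
      have gaps: "(u + \<delta>) * (real (N\<^sup>2 * r N) / (2 * real (N\<^sup>2 * (r N)\<^sup>2))) \<le> \<epsilon>"
        unfolding ratio \<delta>_eq using elim by simp
      have "1 - (2 * u + D N) * D N / \<epsilon>\<^sup>2 \<le> measure (srw_law d N) {X \<in> space (srw_law d N).
          exp (- (2 * u)) \<le> dens (torus d N - visited X (u * real N ^ d)) \<and>
          dens (torus d N - visited X (u * real N ^ d)) \<le> exp (- (u / (8 * G)))}"
        unfolding \<delta>_eq[symmetric] by (rule prob_vacant_density_exp[OF pos_l gap_le G_ge u \<epsilon> \<delta>_le gaps \<epsilon>_le(1) \<epsilon>2])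
      then show ?case
        by simp
    qed
  qed simp
  moreover have "1 / (8 * G) > 0"
    using G_ge by simp
  \<comment> \<open>Both witnesses are free of \<open>u\<close>, and \<open>G\<close> depends on
    \<open>d\<close> alone.\<close>
  ultimately show ?thesis
    by (intro exI[of _ 2] exI[of _ "1 / (8 * G)"]) auto
qed

end
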